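(* Let $0<\beta<1$ and suppose that $v\in C^2(\mathbb S^2)$ satisfies $$-\Delta_{\mathbb S^2}v+\beta=e^{2v}\quad\text{on }\mathbb S^2.$$ Then $v$ must be constant.
   Context: $\mathbb S^2$ is the unit sphere in $\mathbb R^3$ with its standard metric and $\Delta_{\mathbb S^2}$ its Laplace–Beltrami operator. *)

theory Defs
  imports "HOL-Analysis.Analysis"
begin

text \<open>
  The round sphere is the embedded submanifold \<open>S2\<close> of Euclidean 3-space with the induced metric.
  Functions and vector fields on it are total functions on the ambient space, of which only the
  values on \<open>S2\<close> matter: all derivatives are Frechet derivatives \<^emph>\<open>within\<close> \<open>S2\<close>.
\<close>

abbreviation S2 :: "(real ^ 3) set"
  where "S2 \<equiv> sphere 0 1"

definition tangent_space :: "real ^ 3 \<Rightarrow> (real ^ 3) set"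
  where "tangent_space p = {h. h \<bullet> p = 0}"

definition tangent_proj :: "real ^ 3 \<Rightarrow> real ^ 3 \<Rightarrow> real ^ 3"
  where "tangent_proj p h = h - (h \<bullet> p) *\<^sub>R p"

text \<open>
  A derivative within \<open>S2\<close> is determined only on the tangent space at \<open>p\<close>. The differential
  is extended to the ambient space by \<open>0\<close> in the normal direction \<open>p\<close>; see
  \<open>sphere_deriv_ex1\<close> below for existence and uniqueness.
\<close>

definition sphere_deriv :: "(real ^ 3 \<Rightarrow> 'a::real_normed_vector) \<Rightarrow> real ^ 3 \<Rightarrow> real ^ 3 \<Rightarrow> 'a"
  where "sphere_deriv F p = (THE D. (F has_derivative D) (at p within S2) \<and> D p = 0)"

text \<open>
  The constant vectors \<open>h\<close>, projected to the tangent spaces, span each of them, so the continuity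
  condition below is continuity of the differential on the tangent bundle.
\<close>

definition C1_on_S2 :: "(real ^ 3 \<Rightarrow> 'a::real_normed_vector) \<Rightarrow> bool"
  where "C1_on_S2 F \<longleftrightarrow>
    (\<forall>p\<in>S2. F differentiable (at p within S2)) \<and>
    (\<forall>h. continuous_on S2 (\<lambda>p. sphere_deriv F p h))"

definition sphere_grad :: "(real ^ 3 \<Rightarrow> real) \<Rightarrow> real ^ 3 \<Rightarrow> real ^ 3"
  where "sphere_grad v p =
    (THE g. g \<in> tangent_space p \<and> (\<forall>h\<in>tangent_space p. sphere_deriv v p h = g \<bullet> h))"

definition C2_on_S2 :: "(real ^ 3 \<Rightarrow> real) \<Rightarrow> bool"
  where "C2_on_S2 v \<longleftrightarrow> C1_on_S2 v \<and> C1_on_S2 (sphere_grad v)"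

text \<open>
  The Levi-Civita connection of the induced metric is the tangential part of the ambient derivative.
\<close>

definition cov_deriv :: "(real ^ 3 \<Rightarrow> real ^ 3) \<Rightarrow> real ^ 3 \<Rightarrow> real ^ 3 \<Rightarrow> real ^ 3"
  where "cov_deriv X p h = tangent_proj p (sphere_deriv X p h)"

text \<open>
  As an endomorphism of the ambient space, \<open>cov_deriv X p\<close> kills the normal \<open>p\<close> and has tangential
  values, so its trace is the trace of its restriction to the tangent space.
\<close>

definition sphere_div :: "(real ^ 3 \<Rightarrow> real ^ 3) \<Rightarrow> real ^ 3 \<Rightarrow> real"
  where "sphere_div X p = trace (matrix (cov_deriv X p))"

definition laplace_beltrami :: "(real ^ 3 \<Rightarrow> real) \<Rightarrow> real ^ 3 \<Rightarrow> real"
  where "laplace_beltrami v p = sphere_div (sphere_grad v) p"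


lemma tangent_proj_tangent: "p \<in> S2 \<Longrightarrow> tangent_proj p h \<in> tangent_space p"
  by (simp add: tangent_proj_def tangent_space_def algebra_simps dot_square_norm)

lemma tangent_proj_id: "h \<in> tangent_space p \<Longrightarrow> tangent_proj p h = h"
  by (simp add: tangent_proj_def tangent_space_def)

lemma tangent_proj_normal: "p \<in> S2 \<Longrightarrow> tangent_proj p p = 0"
  by (simp add: tangent_proj_def dot_square_norm)

lemma has_derivative_S2_tangent_proj:
  fixes F :: "real ^ 3 \<Rightarrow> 'a::real_normed_vector"
  assumes D: "(F has_derivative D) (at p within S2)" and p: "p \<in> S2"
  shows "(F has_derivative (\<lambda>h. D (tangent_proj p h))) (at p within S2)"
proof -
  interpret D: bounded_linear D
    using D by (rule has_derivative_bounded_linear)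
  let ?c = "\<lambda>y. 1 - (y - p) \<bullet> (y - p) / 2 - y \<bullet> p"
  have "(?c has_derivative (\<lambda>h. - (h \<bullet> p))) (at p within S2)"
    by (auto intro!: derivative_eq_intros)
  then have "((\<lambda>y. F y + ?c y *\<^sub>R D p) has_derivative (\<lambda>h. D h + (- (h \<bullet> p)) *\<^sub>R D p))
      (at p within S2)"
    by (intro has_derivative_add has_derivative_scaleR_left D)
  moreover have "F y + ?c y *\<^sub>R D p = F y" if "y \<in> S2" for y
  proof -
    have "y \<bullet> y = 1" "p \<bullet> p = 1"
      using that p by (auto simp: dot_square_norm)
    then have "?c y = 0"
      by (simp add: inner_diff inner_commute[of p y] field_simps)
    then show ?thesis by simp
  qed
  ultimately have "(F has_derivative (\<lambda>h. D h + (- (h \<bullet> p)) *\<^sub>R D p)) (at p within S2)"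
    by (metis (no_types, lifting) has_derivative_transform p)
  then show ?thesis
    by (simp add: tangent_proj_def D.diff D.scaleR)
qed

lemma has_derivative_S2_unique:
  fixes F :: "real ^ 3 \<Rightarrow> 'a::real_normed_vector"
  assumes D: "(F has_derivative D) (at p within S2)"
    and E: "(F has_derivative E) (at p within S2)"
    and p: "p \<in> S2" and t: "t \<in> tangent_space p"
  shows "D t = E t"
proof -
  define \<gamma> where "\<gamma> s = cos (norm t * s) *\<^sub>R p + sin (norm t * s) *\<^sub>R sgn t" for s :: real
  have tp: "sgn t \<bullet> p = 0"
    using t by (simp add: tangent_space_def sgn_div_norm)
  have pp: "p \<bullet> p = 1"
    using p by (simp add: dot_square_norm)
  have "norm (\<gamma> s) = 1" for s
  proof (cases "t = 0")
    case False
    then have "sgn t \<bullet> sgn t = 1"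
      by (simp add: dot_square_norm norm_sgn)
    then have "\<gamma> s \<bullet> \<gamma> s = (cos (norm t * s))\<^sup>2 + (sin (norm t * s))\<^sup>2"
      using tp pp by (simp add: \<gamma>_def inner_add inner_commute power2_eq_square)
    then show ?thesis
      by (simp add: norm_eq_sqrt_inner)
  qed (use p in \<open>simp add: \<gamma>_def\<close>)
  then have im: "\<gamma> ` UNIV \<subseteq> S2" by auto
  have \<gamma>0: "\<gamma> 0 = p" by (simp add: \<gamma>_def)
  have "(s * norm t) *\<^sub>R sgn t = s *\<^sub>R t" for s
    by (cases "t = 0") (simp_all add: sgn_div_norm)
  then have \<gamma>': "(\<gamma> has_derivative (\<lambda>s. s *\<^sub>R t)) (at 0)"
    unfolding \<gamma>_def by (auto intro!: derivative_eq_intros simp: algebra_simps)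
  have "((\<lambda>s. F (\<gamma> s)) has_vector_derivative L t) (at 0)"
    if L: "(F has_derivative L) (at p within S2)" for L
  proof -
    have "((\<lambda>s. F (\<gamma> s)) has_derivative (\<lambda>s. L (s *\<^sub>R t))) (at 0)"
      using has_derivative_in_compose2[of S2 F "\<lambda>_. L" \<gamma> UNIV 0 "\<lambda>s. s *\<^sub>R t"]
        has_derivative_in_compose[of \<gamma> "\<lambda>s. s *\<^sub>R t" 0 UNIV F L] \<gamma>' im
        has_derivative_subset[OF L, of "\<gamma> ` UNIV"] \<gamma>0
      by simp
    moreover have "L (s *\<^sub>R t) = s *\<^sub>R L t" for s
      using has_derivative_linear[OF L] by (rule linear_scale)
    ultimately show ?thesis
      by (simp add: has_vector_derivative_def)
  qed
  from vector_derivative_unique_at[OF this[OF D] this[OF E]] show ?thesis .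
qed

lemma sphere_deriv_ex1:
  fixes F :: "real ^ 3 \<Rightarrow> 'a::real_normed_vector"
  assumes "F differentiable (at p within S2)" and p: "p \<in> S2"
  shows "\<exists>!D. (F has_derivative D) (at p within S2) \<and> D p = 0"
proof -
  obtain D where D: "(F has_derivative D) (at p within S2)"
    using assms(1) by (auto simp: differentiable_def)
  show ?thesis
  proof (rule ex1I)
    show "(F has_derivative (\<lambda>h. D (tangent_proj p h))) (at p within S2)
        \<and> D (tangent_proj p p) = 0"
      using has_derivative_S2_tangent_proj[OF D p] has_derivative_linear[OF D]
      by (simp add: tangent_proj_normal[OF p] linear_0)
  next
    fix E
    assume E: "(F has_derivative E) (at p within S2) \<and> E p = 0"
    then have lin: "linear E"
      by (blast dest: has_derivative_linear)
    have "E h = D (tangent_proj p h)" for h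
    proof -
      have "E h = E (tangent_proj p h)"
        using E by (simp add: tangent_proj_def linear_diff[OF lin] linear_scale[OF lin])
      also have "\<dots> = D (tangent_proj p h)"
        using E D p tangent_proj_tangent has_derivative_S2_unique by blast
      finally show ?thesis .
    qed
    then show "E = (\<lambda>h. D (tangent_proj p h))" by blast
  qed
qed

lemma sphere_deriv_eq:
  fixes F :: "real ^ 3 \<Rightarrow> 'a::real_normed_vector"
  assumes D: "(F has_derivative D) (at p within S2)" and p: "p \<in> S2"
  shows "sphere_deriv F p = (\<lambda>h. D (tangent_proj p h))"
  unfolding sphere_deriv_def
proof (rule the1_equality)
  show "\<exists>!D. (F has_derivative D) (at p within S2) \<and> D p = 0"
    using D p by (intro sphere_deriv_ex1) (auto simp: differentiable_def)
  show "(F has_derivative (\<lambda>h. D (tangent_proj p h))) (at p within S2)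
      \<and> D (tangent_proj p p) = 0"
    using has_derivative_S2_tangent_proj[OF D p] has_derivative_linear[OF D]
    by (simp add: tangent_proj_normal[OF p] linear_0)
qed

lemma sphere_grad_eq:
  assumes D: "(v has_derivative (\<lambda>h. g \<bullet> h)) (at p within S2)" and p: "p \<in> S2"
  shows "sphere_grad v p = tangent_proj p g"
  unfolding sphere_grad_def
proof (rule the_equality)
  have *: "sphere_deriv v p h = tangent_proj p g \<bullet> h" if "h \<in> tangent_space p" for h
    using that by (simp add: sphere_deriv_eq[OF D p] tangent_proj_id)
      (simp add: tangent_proj_def tangent_space_def algebra_simps inner_commute)
  then show "tangent_proj p g \<in> tangent_space p \<and>
      (\<forall>h\<in>tangent_space p. sphere_deriv v p h = tangent_proj p g \<bullet> h)"
    using tangent_proj_tangent[OF p] by blast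
  fix g'
  assume g': "g' \<in> tangent_space p \<and> (\<forall>h\<in>tangent_space p. sphere_deriv v p h = g' \<bullet> h)"
  let ?d = "g' - tangent_proj p g"
  have "?d \<in> tangent_space p"
    using g' tangent_proj_tangent[OF p, of g] by (simp add: tangent_space_def inner_diff)
  then have "?d \<bullet> ?d = 0"
    using g' * by (metis cancel_comm_monoid_add_class.diff_cancel inner_diff_left)
  then show "g' = tangent_proj p g" by simp
qed

text \<open>Linear functions are eigenfunctions with eigenvalue \<open>- 2\<close>, which fixes sign and scale.\<close>

lemma laplace_beltrami_linear:
  assumes p: "p \<in> S2"
  shows "laplace_beltrami (\<lambda>x. a \<bullet> x) p = - 2 * (a \<bullet> p)"
proof -
  let ?G = "\<lambda>x. tangent_proj x a"
  have grad: "sphere_grad (\<lambda>x. a \<bullet> x) x = ?G x" if "x \<in> S2" for x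
    using that by (intro sphere_grad_eq) (auto intro!: derivative_eq_intros)
  have "(?G has_derivative (\<lambda>h. - ((a \<bullet> p) *\<^sub>R h + (a \<bullet> h) *\<^sub>R p))) (at p within S2)"
    unfolding tangent_proj_def by (auto intro!: derivative_eq_intros)
  then have D: "(sphere_grad (\<lambda>x. a \<bullet> x) has_derivative (\<lambda>h. - ((a \<bullet> p) *\<^sub>R h + (a \<bullet> h) *\<^sub>R p)))
      (at p within S2)"
    using grad p by (metis (no_types, lifting) has_derivative_transform)
  have pp: "p \<bullet> p = 1"
    using p by (simp add: dot_square_norm)
  have "cov_deriv (sphere_grad (\<lambda>x. a \<bullet> x)) p h = - (a \<bullet> p) *\<^sub>R tangent_proj p h" for h
  proof -
    have "tangent_proj p (- (c *\<^sub>R t + d *\<^sub>R p)) = - c *\<^sub>R tangent_proj p t" for c d t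
      using pp
      by (simp add: tangent_proj_def inner_diff_left scaleR_diff_left scaleR_diff_right)
    then show ?thesis
      unfolding cov_deriv_def sphere_deriv_eq[OF D p]
      by (simp only: tangent_proj_id[OF tangent_proj_tangent[OF p]])
  qed
  then have "cov_deriv (sphere_grad (\<lambda>x. a \<bullet> x)) p = (\<lambda>h. - (a \<bullet> p) *\<^sub>R tangent_proj p h)"
    by blast
  then have "trace (matrix (cov_deriv (sphere_grad (\<lambda>x. a \<bullet> x)) p))
      = (\<Sum>i\<in>UNIV. - (a \<bullet> p) * (1 - p $ i * p $ i))"
    by (simp add: trace_def matrix_def tangent_proj_def inner_axis')
  also have "\<dots> = - (a \<bullet> p) * (\<Sum>i\<in>UNIV. 1 - p $ i * p $ i)"
    by (rule sum_distrib_left [symmetric])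
  also have "(\<Sum>i\<in>UNIV. 1 - p $ i * p $ i) = 2"
    using pp by (simp add: sum_subtractf inner_vec_def)
  finally show ?thesis
    by (simp add: laplace_beltrami_def sphere_div_def)
qed

end

theory Submission
  imports Defs
begin

text \<open>
  The substitution \<open>w = exp (- v)\<close> turns the equation into
  \<open>w \<Delta>w = 1 + \<bar>\<nabla>w\<bar>\<^sup>2 - \<beta> w\<^sup>2\<close>. Let \<open>E = \<nabla>\<^sup>2w - (\<Delta>w / 2) g\<close> be the traceless Hessian. The Bochner
  computation of Obata gives
  \<open>div (E(\<nabla>w) / w) = \<bar>E\<bar>\<^sup>2 / w + (1 - \<beta>) \<bar>\<nabla>w\<bar>\<^sup>2 / w\<close>.
  Both terms on the right are nonnegative and the left side integrates to zero, so \<open>\<nabla>w = 0\<close>.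

  Two devices make this work by elementary means. The first is to pass to the homogeneous extension
  \<open>U(x) = \<bar>x\<bar> w(x / \<bar>x\<bar>)\<close> of degree one on the punctured space. The radial direction lies in the kernel of
  its Euclidean Hessian \<open>H\<close>, and the tangential part of \<open>H\<close> is \<open>(\<nabla>\<^sup>2w + w g) / \<bar>x\<bar>\<close>, so that the curvature
  term of the sphere is absorbed. With \<open>G = \<nabla>U\<close> and \<open>Q = trace H\<close> the equation becomes
  \<open>U Q = \<bar>G\<bar>\<^sup>2 + 1 + (1 - \<beta>) U\<^sup>2 / \<bar>x\<bar>\<^sup>2\<close>, and the vector field \<open>(H G - (Q / 2) G) / U\<close> has the divergence
  \<open>(\<bar>H\<bar>\<^sup>2 - Q\<^sup>2 / 2) / U + (1 - \<beta>) (\<bar>G\<bar>\<^sup>2 - U\<^sup>2 / \<bar>x\<bar>\<^sup>2) / (\<bar>x\<bar>\<^sup>2 U)\<close>. Here \<open>Q\<^sup>2 \<le> 2 \<bar>H\<bar>\<^sup>2\<close> because \<open>H\<close> has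
  rank at most two (\<open>trace_square_le\<close>), and \<open>U\<^sup>2 \<le> \<bar>G\<bar>\<^sup>2 \<bar>x\<bar>\<^sup>2\<close> is the Cauchy-Schwarz inequality applied to
  Euler's relation \<open>G \<bullet> x = U\<close>. The identity is multiplied by a radial cutoff \<open>\<eta>\<close> and integrated over
  the whole space. The radial part of the field leaves \<open>\<integral> Q \<eta>'(\<bar>x\<bar>\<^sup>2)\<close>, which is zero because \<open>Q\<close> has
  degree \<open>- 1\<close>.

  The second device deals with regularity: \<open>v\<close> is only of class \<open>C\<^sup>2\<close>, whereas the divergence above
  contains third derivatives. The trace \<open>Q\<close> is of class \<open>C\<^sup>1\<close> by the equation, so its derivatives may be
  used. The remaining third derivatives disappear when the identity is written with the expressions
  \<open>\<partial>\<^sub>i \<partial>\<^sub>j U \<partial>\<^sub>j \<phi> - \<partial>\<^sub>j \<partial>\<^sub>j U \<partial>\<^sub>i \<phi>\<close>, where \<open>\<phi> = \<eta> \<partial>\<^sub>i U / U\<close>. These are \<open>2 \<times> 2\<close> minors of the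
  gradients of \<open>\<partial>\<^sub>j U\<close> and \<open>\<phi>\<close>, and such minors are
  null Lagrangians: their integral vanishes for functions of class \<open>C\<^sup>1\<close>
  (\<open>integral_gradient_minor_zero\<close>). Difference quotients and the translation invariance of Lebesgue
  measure suffice to prove this. The symmetry of \<open>H\<close> comes from the same lemma.
\<close>

section \<open>Compactly supported functions of class \<open>C\<^sup>1\<close>\<close>

text \<open>
  The gradient \<open>g\<close> is carried along explicitly, so that integral identities can be stated in terms of
  the gradient that the calculus rules produce.
\<close>

definition C1_compact :: "('a::euclidean_space \<Rightarrow> real) \<Rightarrow> ('a \<Rightarrow> 'a) \<Rightarrow> bool" where
  "C1_compact f g \<longleftrightarrow> (\<forall>x. (f has_derivative (\<lambda>h. g x \<bullet> h)) (at x)) \<and>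
     continuous_on UNIV g \<and> bounded {x. f x \<noteq> 0}"

lemma C1_compact_continuous: "C1_compact f g \<Longrightarrow> continuous_on UNIV f"
  unfolding C1_compact_def
  by (meson continuous_at_imp_continuous_on has_derivative_continuous)

lemma C1_compact_gradient_continuous: "C1_compact f g \<Longrightarrow> continuous_on UNIV g"
  unfolding C1_compact_def by blast

lemma C1_compact_gradient_zero_on_open:
  assumes f: "C1_compact f g" and S: "open S" "x \<in> S" and zero: "\<And>y. y \<in> S \<Longrightarrow> f y = 0"
  shows "g x = 0"
proof -
  have "(f has_derivative (\<lambda>h. 0)) (at x)"
    by (rule has_derivative_transform_within_open[OF has_derivative_const[of 0] S])
      (simp add: zero)
  then have "(\<lambda>h. g x \<bullet> h) = (\<lambda>h. 0)"
    using f unfolding C1_compact_def by (blast intro: has_derivative_unique)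
  then have "g x \<bullet> g x = 0"
    by (rule fun_cong)
  then show ?thesis by simp
qed

lemma C1_compact_gradient_support:
  assumes f: "C1_compact f g"
  shows "bounded {x. g x \<noteq> 0}"
proof -
  obtain R where R: "\<And>x. f x \<noteq> 0 \<Longrightarrow> norm x \<le> R"
    using assms unfolding C1_compact_def bounded_iff by auto
  have "open {x::'a. norm x > R}"
    by (intro open_Collect_less continuous_intros)
  then have "g x = 0" if "norm x > R" for x
    by (rule C1_compact_gradient_zero_on_open[OF f]) (use R that in force)+
  then have "norm x \<le> R" if "g x \<noteq> 0" for x
    using that by (meson not_le)
  then show ?thesis
    unfolding bounded_iff by blast
qed

lemma C1_compact_mult:
  assumes "C1_compact f g" "C1_compact \<phi> \<gamma>"
  shows "C1_compact (\<lambda>x. f x * \<phi> x) (\<lambda>x. \<phi> x *\<^sub>R g x + f x *\<^sub>R \<gamma> x)"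
proof -
  have "bounded {x. f x * \<phi> x \<noteq> 0}"
    by (rule bounded_subset[of "{x. f x \<noteq> 0}"]) (use assms in \<open>auto simp: C1_compact_def\<close>)
  moreover have "((\<lambda>x. f x * \<phi> x) has_derivative (\<lambda>h. (\<phi> x *\<^sub>R g x + f x *\<^sub>R \<gamma> x) \<bullet> h)) (at x)" for x
    using assms unfolding C1_compact_def
    by (auto intro!: derivative_eq_intros simp: algebra_simps)
  ultimately show ?thesis
    using assms C1_compact_continuous[OF assms(1)] C1_compact_continuous[OF assms(2)]
    unfolding C1_compact_def by (auto intro!: continuous_intros)
qed

lemma C1_compact_translate:
  assumes "C1_compact f g"
  shows "C1_compact (\<lambda>x. f (x + a)) (\<lambda>x. g (x + a))"
proof -
  have "((\<lambda>x. f (x + a)) has_derivative (\<lambda>h. g (x + a) \<bullet> h)) (at x)" for x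
    by (rule has_derivative_compose[of "\<lambda>x. x + a" "\<lambda>h. h" x UNIV f "\<lambda>h. g (x + a) \<bullet> h"])
      (use assms in \<open>auto simp: C1_compact_def intro!: derivative_eq_intros\<close>)
  moreover have "continuous_on UNIV (\<lambda>x. g (x + a))"
    using assms unfolding C1_compact_def
    by (auto intro!: continuous_on_compose2[of UNIV g] continuous_intros)
  moreover obtain R where R: "\<And>x. f x \<noteq> 0 \<Longrightarrow> norm x \<le> R"
    using assms unfolding C1_compact_def bounded_iff by auto
  have "norm x \<le> R + norm a" if "f (x + a) \<noteq> 0" for x
    using R[OF that] norm_triangle_ineq4[of "x + a" a] by simp
  then have "bounded {x. f (x + a) \<noteq> 0}"
    unfolding bounded_iff by blast
  ultimately show ?thesis
    unfolding C1_compact_def by auto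
qed

lemma integrable_continuous_bounded_support:
  fixes f :: "'a::euclidean_space \<Rightarrow> real"
  assumes "continuous_on UNIV f" "bounded {x. f x \<noteq> 0}"
  shows "integrable lborel f"
proof -
  obtain R where R: "\<And>x. f x \<noteq> 0 \<Longrightarrow> norm x \<le> R"
    using assms unfolding bounded_iff by auto
  have "integrable lborel (\<lambda>x. indicator (cball 0 R) x *\<^sub>R f x)"
    by (rule borel_integrable_compact) (use assms continuous_on_subset in auto)
  moreover have "(\<lambda>x. indicator (cball 0 R) x *\<^sub>R f x) = f"
  proof
    show "indicator (cball 0 R) x *\<^sub>R f x = f x" for x
      using R[of x] by (cases "f x = 0") auto
  qed
  ultimately show ?thesis by simp
qed

lemma integrable_mult_C1_compact:
  assumes "C1_compact f g" "continuous_on UNIV \<theta>"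
  shows "integrable lborel (\<lambda>x. f x * \<theta> x)"
proof (rule integrable_continuous_bounded_support)
  show "bounded {x. f x * \<theta> x \<noteq> 0}"
    by (rule bounded_subset[of "{x. f x \<noteq> 0}"]) (use assms in \<open>auto simp: C1_compact_def\<close>)
qed (intro continuous_intros C1_compact_continuous[OF assms(1)] assms(2))

lemma integrable_gradient_mult_continuous:
  assumes "C1_compact f g" "continuous_on UNIV \<theta>"
  shows "integrable lborel (\<lambda>x. (g x \<bullet> a) * \<theta> x)"
proof (rule integrable_continuous_bounded_support)
  show "bounded {x. (g x \<bullet> a) * \<theta> x \<noteq> 0}"
    by (rule bounded_subset[OF C1_compact_gradient_support[OF assms(1)]]) auto
qed (intro continuous_intros C1_compact_gradient_continuous[OF assms(1)] assms(2))

lemma integral_lborel_translate: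
  fixes f :: "'a::euclidean_space \<Rightarrow> real"
  assumes "continuous_on UNIV f"
  shows "(\<integral>x. f (x + a) \<partial>lborel) = (\<integral>x. f x \<partial>lborel)"
proof -
  have "(\<integral>x. f x \<partial>distr lborel borel ((+) a)) = (\<integral>x. f (a + x) \<partial>lborel)"
    by (rule integral_distr) (use assms borel_measurable_continuous_onI in auto)
  then show ?thesis
    unfolding lborel_distr_plus by (simp add: add.commute)
qed

text \<open>
  Dominated convergence: by the mean value inequality the quotients are bounded by the supremum of
  \<open>g\<close> over a ball, and all of them vanish outside a common ball.
\<close>

lemma integral_difference_quotient_tendsto:
  assumes f: "C1_compact f g" and \<theta>: "continuous_on UNIV \<theta>"
  shows "(\<lambda>n. \<integral>x. (f (x + (1 / real (Suc n)) *\<^sub>R a) - f x) * real (Suc n) * \<theta> x \<partial>lborel)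
     \<longlonglongrightarrow> (\<integral>x. (g x \<bullet> a) * \<theta> x \<partial>lborel)"
proof -
  obtain R where R: "\<And>x. f x \<noteq> 0 \<Longrightarrow> norm x \<le> R"
    using f unfolding C1_compact_def bounded_iff by auto
  have gc: "continuous_on UNIV g" and der: "\<And>x. (f has_derivative (\<lambda>h. g x \<bullet> h)) (at x)"
    using f unfolding C1_compact_def by auto
  define S where "S = cball (0::'a) (R + norm a)"
  define S' where "S' = cball (0::'a) (R + norm a + norm a)"
  have "bounded (g ` S')"
    by (intro compact_imp_bounded compact_continuous_image continuous_on_subset[OF gc])
      (auto simp: S'_def)
  then obtain B where B: "\<And>x. x \<in> S' \<Longrightarrow> norm (g x) \<le> B" and B0: "B > 0"
    unfolding bounded_pos by auto
  have "bounded (\<theta> ` S)"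
    by (intro compact_imp_bounded compact_continuous_image continuous_on_subset[OF \<theta>])
      (auto simp: S_def)
  then obtain C where C: "\<And>x. x \<in> S \<Longrightarrow> \<bar>\<theta> x\<bar> \<le> C" and C0: "C > 0"
    unfolding bounded_pos by auto
  let ?D = "\<lambda>n x. (f (x + (1 / real (Suc n)) *\<^sub>R a) - f x) * real (Suc n)"
  have Dbound: "\<bar>?D n x\<bar> \<le> B * norm a" if "x \<in> S" for n x
  proof -
    let ?y = "x + (1 / real (Suc n)) *\<^sub>R a"
    have small: "norm ((1 / real (Suc n)) *\<^sub>R a) \<le> norm a"
      by (simp add: divide_simps) (simp add: algebra_simps)
    have "norm x \<le> R + norm a"
      using that by (simp add: S_def)
    then have "x \<in> S'" "?y \<in> S'"
      using small norm_triangle_ineq[of x "(1 / real (Suc n)) *\<^sub>R a"] norm_ge_zero[of a]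
      unfolding S'_def mem_cball_0 by linarith+
    then have "norm (f ?y - f x) \<le> B * norm (?y - x)"
    proof (intro differentiable_bound[of S' f "\<lambda>x h. g x \<bullet> h"])
      fix z assume z: "z \<in> S'"
      show "onorm (\<lambda>h. g z \<bullet> h) \<le> B"
      proof (rule onorm_le)
        fix h
        have "\<bar>g z \<bullet> h\<bar> \<le> norm (g z) * norm h"
          by (rule Cauchy_Schwarz_ineq2)
        also have "\<dots> \<le> B * norm h"
          by (rule mult_right_mono[OF B[OF z]]) simp
        finally show "norm (g z \<bullet> h) \<le> B * norm h"
          by simp
      qed
    qed (auto simp: S'_def intro!: has_derivative_at_withinI[OF der])
    then have "\<bar>f ?y - f x\<bar> * real (Suc n) \<le> B * norm (?y - x) * real (Suc n)"
      by (intro mult_right_mono) auto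
    also have "\<dots> = B * norm a"
      by simp
    finally show ?thesis
      by (simp add: abs_mult)
  qed
  have D0: "?D n x = 0" if "x \<notin> S" for n x
  proof -
    have "norm ((1 / real (Suc n)) *\<^sub>R a) \<le> norm a"
      by (simp add: divide_simps) (simp add: algebra_simps)
    then have "norm (x + (1 / real (Suc n)) *\<^sub>R a) > R"
      using that norm_triangle_ineq4[of "x + (1 / real (Suc n)) *\<^sub>R a" "(1 / real (Suc n)) *\<^sub>R a"]
      by (simp add: S_def del: norm_scaleR)
    moreover have "norm x > R"
      using that norm_ge_zero[of a] unfolding S_def mem_cball_0 by linarith
    ultimately have "f (x + (1 / real (Suc n)) *\<^sub>R a) = 0" "f x = 0"
      using R by (meson not_le)+
    then show ?thesis by simp
  qed
  have fc: "continuous_on UNIV f"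
    by (rule C1_compact_continuous[OF f])
  show ?thesis
  proof (rule integral_dominated_convergence)
    show "(\<lambda>x. (g x \<bullet> a) * \<theta> x) \<in> borel_measurable lborel"
      using integrable_gradient_mult_continuous[OF f \<theta>] by blast
    show "(\<lambda>x. ?D n x * \<theta> x) \<in> borel_measurable lborel" for n
    proof -
      have "continuous_on UNIV (\<lambda>x. ?D n x * \<theta> x)"
        by (intro continuous_intros \<theta> fc continuous_on_compose2[OF fc]) auto
      then show ?thesis
        using borel_measurable_continuous_onI by simp
    qed
    have "integrable lborel (\<lambda>x. indicator S x *\<^sub>R (B * norm a * C))"
      by (rule borel_integrable_compact) (auto simp: S_def)
    then show "integrable lborel (\<lambda>x. indicator S x * (B * norm a * C))"
      by simp
    show "AE x in lborel. (\<lambda>n. ?D n x * \<theta> x) \<longlonglongrightarrow> (g x \<bullet> a) * \<theta> x"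
    proof (intro AE_I2 tendsto_mult_right)
      fix x
      have "((\<lambda>t. f (x + t *\<^sub>R a)) has_derivative (\<lambda>t. g x \<bullet> (t *\<^sub>R a))) (at 0)"
        by (rule has_derivative_compose[of "\<lambda>t. x + t *\<^sub>R a" "\<lambda>t. t *\<^sub>R a" 0 UNIV f "\<lambda>h. g x \<bullet> h"])
          (use der[of x] in \<open>auto intro!: derivative_eq_intros\<close>)
      then have "((\<lambda>t. f (x + t *\<^sub>R a)) has_real_derivative g x \<bullet> a) (at 0)"
        by (simp add: has_field_derivative_def mult.commute[of _ "g x \<bullet> a"])
      then have lim: "((\<lambda>h. (f (x + h *\<^sub>R a) - f x) / h) \<longlongrightarrow> g x \<bullet> a) (at 0)"
        by (simp add: DERIV_def)
      have "filterlim (\<lambda>n. 1 / real (Suc n)) (at 0) sequentially"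
        unfolding filterlim_at using LIMSEQ_inverse_real_of_nat by (auto simp: inverse_eq_divide)
      from filterlim_compose[OF lim this] show "(\<lambda>n. ?D n x) \<longlonglongrightarrow> g x \<bullet> a"
        by simp
    qed
    show "AE x in lborel. norm (?D n x * \<theta> x) \<le> indicator S x * (B * norm a * C)" for n
    proof (intro AE_I2)
      fix x
      show "norm (?D n x * \<theta> x) \<le> indicator S x * (B * norm a * C)"
      proof (cases "x \<in> S")
        case True
        then show ?thesis
          using mult_mono[OF Dbound[OF True, of n] C[OF True]] B0
          by (simp add: abs_mult)
      next
        case False
        then show ?thesis
          using D0 by simp
      qed
    qed
  qed
qed

text \<open>
  By translation invariance the integral of every difference quotient vanishes already before the
  limit is taken.
\<close>

lemma integral_directional_derivative_zero:
  assumes f: "C1_compact f g"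
  shows "(\<integral>x. g x \<bullet> a \<partial>lborel) = 0"
proof -
  have "(\<integral>x. (f (x + b) - f x) * c * 1 \<partial>lborel) = 0" for b c
  proof -
    have "integrable lborel f" "integrable lborel (\<lambda>x. f (x + b))"
      using integrable_mult_C1_compact[OF f, of "\<lambda>_. 1"]
        integrable_mult_C1_compact[OF C1_compact_translate[OF f], of "\<lambda>_. 1" b] by auto
    then show ?thesis
      by (simp add: integral_lborel_translate[OF C1_compact_continuous[OF f]])
  qed
  then have "(\<lambda>n::nat. 0) \<longlonglongrightarrow> (\<integral>x. (g x \<bullet> a) * 1 \<partial>lborel)"
    using integral_difference_quotient_tendsto[OF f, of "\<lambda>_. 1" a] by (simp only: continuous_on_const)
  then show ?thesis
    by (simp add: LIMSEQ_const_iff)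
qed

lemma integral_by_parts:
  assumes f: "C1_compact f g" and \<phi>: "C1_compact \<phi> \<gamma>"
  shows "(\<integral>x. f x * (\<gamma> x \<bullet> a) \<partial>lborel) = - (\<integral>x. (g x \<bullet> a) * \<phi> x \<partial>lborel)"
proof -
  have "integrable lborel (\<lambda>x. (g x \<bullet> a) * \<phi> x)" "integrable lborel (\<lambda>x. f x * (\<gamma> x \<bullet> a))"
    using integrable_gradient_mult_continuous[OF f C1_compact_continuous[OF \<phi>]]
      integrable_gradient_mult_continuous[OF \<phi> C1_compact_continuous[OF f]]
    by (auto simp: mult.commute)
  then show ?thesis
    using integral_directional_derivative_zero[OF C1_compact_mult[OF f \<phi>], of a]
    by (simp add: inner_add_left mult.commute)
qed

text \<open>
  For functions of class \<open>C\<^sup>2\<close> this is two integrations by parts, which exchange the directions \<open>a\<close> and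
  \<open>b\<close>. In class \<open>C\<^sup>1\<close> one of the two derivatives is replaced by a difference quotient: it can be moved
  from \<open>f\<close> to \<open>\<phi>\<close> by a translation, and it commutes with the derivative in direction \<open>b\<close>.
\<close>

lemma integral_gradient_minor_zero:
  assumes f: "C1_compact f g" and \<phi>: "C1_compact \<phi> \<gamma>"
  shows "(\<integral>x. (g x \<bullet> a) * (\<gamma> x \<bullet> b) \<partial>lborel) = (\<integral>x. (g x \<bullet> b) * (\<gamma> x \<bullet> a) \<partial>lborel)"
proof (rule LIMSEQ_unique)
  have gc: "continuous_on UNIV (\<lambda>x. g x \<bullet> b)" "continuous_on UNIV (\<lambda>x. \<gamma> x \<bullet> b)"
    by (intro continuous_intros C1_compact_gradient_continuous[OF f] C1_compact_gradient_continuous[OF \<phi>])+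
  show "(\<lambda>n. \<integral>x. (f (x + (1 / real (Suc n)) *\<^sub>R a) - f x) * real (Suc n) * (\<gamma> x \<bullet> b) \<partial>lborel)
     \<longlonglongrightarrow> (\<integral>x. (g x \<bullet> a) * (\<gamma> x \<bullet> b) \<partial>lborel)"
    by (rule integral_difference_quotient_tendsto[OF f gc(2)])
  have "(\<integral>x. (f (x + h) - f x) * c * (\<gamma> x \<bullet> b) \<partial>lborel) =
      - (\<integral>x. (\<phi> (x - h) - \<phi> x) * c * (g x \<bullet> b) \<partial>lborel)" for h c
  proof -
    note f' = C1_compact_translate[OF f, of h] and \<phi>' = C1_compact_translate[OF \<phi>, of "-h"]
    have "(\<integral>x. f (x + h) * (\<gamma> x \<bullet> b) \<partial>lborel) = (\<integral>x. f x * (\<gamma> (x - h) \<bullet> b) \<partial>lborel)"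
      using integral_lborel_translate[of "\<lambda>x. f x * (\<gamma> (x - h) \<bullet> b)" h]
        C1_compact_continuous[OF f] C1_compact_gradient_continuous[OF \<phi>']
      by (simp add: continuous_intros)
    also have "\<dots> = - (\<integral>x. (g x \<bullet> b) * \<phi> (x - h) \<partial>lborel)"
      using integral_by_parts[OF f \<phi>'] by simp
    finally have 1: "(\<integral>x. f (x + h) * (\<gamma> x \<bullet> b) \<partial>lborel) = - (\<integral>x. \<phi> (x - h) * (g x \<bullet> b) \<partial>lborel)"
      by (simp add: mult.commute)
    have 2: "(\<integral>x. f x * (\<gamma> x \<bullet> b) \<partial>lborel) = - (\<integral>x. \<phi> x * (g x \<bullet> b) \<partial>lborel)"
      using integral_by_parts[OF f \<phi>] by (simp add: mult.commute)
    have I: "integrable lborel (\<lambda>x. f (x + h) * (\<gamma> x \<bullet> b))" "integrable lborel (\<lambda>x. f x * (\<gamma> x \<bullet> b))"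
      "integrable lborel (\<lambda>x. \<phi> (x - h) * (g x \<bullet> b))" "integrable lborel (\<lambda>x. \<phi> x * (g x \<bullet> b))"
      using integrable_mult_C1_compact[OF f' gc(2)] integrable_mult_C1_compact[OF f gc(2)]
        integrable_mult_C1_compact[OF \<phi>' gc(1)] integrable_mult_C1_compact[OF \<phi> gc(1)] by auto
    have "(\<integral>x. (f (x + h) - f x) * c * (\<gamma> x \<bullet> b) \<partial>lborel)
        = c * ((\<integral>x. f (x + h) * (\<gamma> x \<bullet> b) \<partial>lborel) - (\<integral>x. f x * (\<gamma> x \<bullet> b) \<partial>lborel))"
      by (subst Bochner_Integration.integral_diff[symmetric, OF I(1,2)],
          subst integral_mult_right_zero[symmetric])
        (auto intro!: Bochner_Integration.integral_cong simp: algebra_simps)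
    also have "\<dots> = - (c * ((\<integral>x. \<phi> (x - h) * (g x \<bullet> b) \<partial>lborel) - (\<integral>x. \<phi> x * (g x \<bullet> b) \<partial>lborel)))"
      unfolding 1 2 by (simp add: algebra_simps)
    also have "\<dots> = - (\<integral>x. (\<phi> (x - h) - \<phi> x) * c * (g x \<bullet> b) \<partial>lborel)"
      by (subst Bochner_Integration.integral_diff[symmetric, OF I(3,4)],
          subst integral_mult_right_zero[symmetric])
        (auto intro!: Bochner_Integration.integral_cong simp: algebra_simps)
    finally show ?thesis .
  qed
  then show "(\<lambda>n. \<integral>x. (f (x + (1 / real (Suc n)) *\<^sub>R a) - f x) * real (Suc n) * (\<gamma> x \<bullet> b) \<partial>lborel)
     \<longlonglongrightarrow> (\<integral>x. (g x \<bullet> b) * (\<gamma> x \<bullet> a) \<partial>lborel)"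
    using tendsto_minus[OF integral_difference_quotient_tendsto[OF \<phi> gc(1), of "- a"]]
    by (simp add: mult.commute)
qed

lemma continuous_integral_zero_imp_zero:
  fixes f :: "'a::euclidean_space \<Rightarrow> real"
  assumes cont: "continuous_on UNIV f" and "bounded {x. f x \<noteq> 0}"
    and nn: "\<And>x. f x \<ge> 0" and 0: "(\<integral>x. f x \<partial>lborel) = 0"
  shows "f x = 0"
proof -
  have "integrable lborel f"
    by (rule integrable_continuous_bounded_support) fact+
  then have "AE x in lborel. f x = 0"
    using 0 nn by (subst (asm) integral_nonneg_eq_0_iff_AE) auto
  then have "AE x in lebesgue. f x = 0"
    by (rule AE_completion)
  then have "negligible {x. f x \<noteq> 0}"
    by (simp add: negligible_iff_null_sets AE_iff_null_sets eventually_ae_filter)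
      (metis (mono_tags, lifting) completion.complete2 mem_Collect_eq subsetI)
  moreover have "open {x. f x \<noteq> 0}"
    by (intro open_Collect_neq cont continuous_intros)
  ultimately have "{x. f x \<noteq> 0} = {}"
    using open_not_negligible by blast
  then show ?thesis by blast
qed

section \<open>Cutoff functions\<close>

text \<open>
  The building block of all cutoffs: it is of class \<open>C\<^sup>1\<close>, which is the regularity that the integral
  identities ask for.
\<close>

definition pos_square :: "real \<Rightarrow> real" where
  "pos_square t = (max 0 t)\<^sup>2"

lemma pos_square_deriv: "(pos_square has_real_derivative 2 * max 0 t) (at t)"
proof -
  have "(pos_square has_real_derivative 2 * max 0 t) (at t)" if "t \<noteq> 0"
  proof (cases "t > 0")
    case True
    have "((\<lambda>t. t\<^sup>2) has_real_derivative 2 * t) (at t)"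
      by (auto intro!: derivative_eq_intros)
    then have "(pos_square has_real_derivative 2 * t) (at t)"
      by (rule has_field_derivative_transform_within_open[of _ _ _ "{0<..}"])
        (use True in \<open>auto simp: pos_square_def\<close>)
    then show ?thesis using True by simp
  next
    case False
    have "((\<lambda>t. 0) has_real_derivative 0) (at t)"
      by simp
    then have "(pos_square has_real_derivative 0) (at t)"
      by (rule has_field_derivative_transform_within_open[of _ _ _ "{..<0}"])
        (use False that in \<open>auto simp: pos_square_def\<close>)
    then show ?thesis using False by simp
  qed
  moreover have "(pos_square has_real_derivative 0) (at 0)"
  proof -
    have "((\<lambda>h. max 0 h) \<longlongrightarrow> max 0 (0::real)) (at 0)"
      by (intro tendsto_intros)
    moreover have "(pos_square (0 + h) - pos_square 0) / h = max 0 h" if "h \<noteq> 0" for h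
      using that by (auto simp: pos_square_def max_def power2_eq_square)
    ultimately show ?thesis
      unfolding DERIV_def by (subst tendsto_cong) (auto simp: eventually_at_filter)
  qed
  ultimately show ?thesis
    by (cases "t = 0") auto
qed

lemma pos_square_chain:
  assumes "(u has_real_derivative u') (at s)"
  shows "((\<lambda>s. pos_square (u s)) has_real_derivative 2 * max 0 (u s) * u') (at s)"
  using DERIV_chain2[OF pos_square_deriv assms] by simp

lemma pos_square_ge_0: "pos_square t \<ge> 0"
  by (simp add: pos_square_def)

lemma pos_square_eq_0_iff: "pos_square t = 0 \<longleftrightarrow> t \<le> 0"
  by (auto simp: pos_square_def max_def)

lemma continuous_on_pos_square:
  "continuous_on A u \<Longrightarrow> continuous_on A (\<lambda>x. pos_square (u x))"
  unfolding pos_square_def by (intro continuous_intros)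

text \<open>
  A cutoff is applied to the squared radius. The positive lower bound \<open>a\<close> keeps the support of the
  resulting function away from the origin, where homogeneous functions are singular.
\<close>

definition cutoff :: "(real \<Rightarrow> real) \<Rightarrow> (real \<Rightarrow> real) \<Rightarrow> bool" where
  "cutoff \<zeta> \<zeta>' \<longleftrightarrow> (\<forall>s. (\<zeta> has_real_derivative \<zeta>' s) (at s)) \<and> continuous_on UNIV \<zeta>' \<and>
     (\<exists>a>0. \<exists>b. \<forall>s. \<zeta> s \<noteq> 0 \<longrightarrow> a \<le> s \<and> s \<le> b)"

definition bump :: "real \<Rightarrow> real" where
  "bump s = pos_square (s - 1) * pos_square (4 - s)"

definition bump' :: "real \<Rightarrow> real" where
  "bump' s = 2 * max 0 (s - 1) * pos_square (4 - s) - pos_square (s - 1) * (2 * max 0 (4 - s))"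

text \<open>
  Equal to one on the support \<open>{1..4}\<close> of \<^term>\<open>bump\<close>. The factor \<open>4\<close> makes the first factor vanish for
  \<open>s \<le> 1 / 2\<close>.
\<close>

definition plateau :: "real \<Rightarrow> real" where
  "plateau s = pos_square (1 - 4 * pos_square (1 - s)) * pos_square (1 - pos_square (s - 4))"

definition plateau' :: "real \<Rightarrow> real" where
  "plateau' s =
     2 * max 0 (1 - 4 * pos_square (1 - s)) * (8 * max 0 (1 - s)) * pos_square (1 - pos_square (s - 4))
     - pos_square (1 - 4 * pos_square (1 - s)) * (2 * max 0 (1 - pos_square (s - 4)) * (2 * max 0 (s - 4)))"

lemma bump_pos: "1 < s \<Longrightarrow> s < 4 \<Longrightarrow> bump s > 0"
  by (simp add: bump_def pos_square_def)

lemma bump_outside: "\<not> (1 < s \<and> s < 4) \<Longrightarrow> bump s = 0 \<and> bump' s = 0"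
  by (auto simp: bump_def bump'_def pos_square_def)

lemma plateau_inside: "1 \<le> s \<Longrightarrow> s \<le> 4 \<Longrightarrow> plateau s = 1 \<and> plateau' s = 0"
  by (simp add: plateau_def plateau'_def pos_square_def)

lemma cutoff_bump: "cutoff bump bump'"
  unfolding cutoff_def
proof (intro conjI allI)
  fix s
  have "(bump has_real_derivative
      2 * max 0 (s - 1) * 1 * pos_square (4 - s) + 2 * max 0 (4 - s) * (-1) * pos_square (s - 1)) (at s)"
    unfolding bump_def
    by (intro DERIV_mult pos_square_chain) (auto intro!: derivative_eq_intros)
  then show "(bump has_real_derivative bump' s) (at s)"
    by (simp add: bump'_def algebra_simps)
  show "continuous_on UNIV bump'"
    unfolding bump'_def by (intro continuous_intros continuous_on_pos_square)
  have "1 \<le> s \<and> s \<le> 4" if "bump s \<noteq> 0" for s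
    using bump_outside[of s] that by fastforce
  then show "\<exists>a>0. \<exists>b. \<forall>s. bump s \<noteq> 0 \<longrightarrow> a \<le> s \<and> s \<le> b"
    using zero_less_one by blast
qed

lemma cutoff_plateau: "cutoff plateau plateau'"
  unfolding cutoff_def
proof (intro conjI allI)
  fix s
  have "(plateau has_real_derivative
      2 * max 0 (1 - 4 * pos_square (1 - s)) * (- (4 * (2 * max 0 (1 - s) * (- 1)))) *
        pos_square (1 - pos_square (s - 4)) +
      2 * max 0 (1 - pos_square (s - 4)) * (- (2 * max 0 (s - 4) * 1)) *
        pos_square (1 - 4 * pos_square (1 - s))) (at s)"
    unfolding plateau_def
    by (intro DERIV_mult pos_square_chain)
      (auto intro!: derivative_eq_intros pos_square_chain)
  then show "(plateau has_real_derivative plateau' s) (at s)"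
    by (simp add: plateau'_def algebra_simps)
  show "continuous_on UNIV plateau'"
    unfolding plateau'_def by (intro continuous_intros continuous_on_pos_square)
  have "1 / 2 \<le> s \<and> s \<le> 5" if s: "plateau s \<noteq> 0" for s
  proof (rule ccontr)
    assume "\<not> (1 / 2 \<le> s \<and> s \<le> 5)"
    then consider "1 / 2 < 1 - s" | "1 < s - 4"
      by linarith
    then show False
    proof cases
      case 1
      then have "(1/2)\<^sup>2 \<le> (1 - s)\<^sup>2"
        by (intro power_mono) auto
      then have "pos_square (1 - s) \<ge> 1 / 4"
        using 1 by (simp add: pos_square_def power2_eq_square)
      then show False
        using s by (simp add: plateau_def pos_square_eq_0_iff)
    next
      case 2
      then have "1\<^sup>2 \<le> (s - 4)\<^sup>2"
        by (intro power_mono) auto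
      then have "pos_square (s - 4) \<ge> 1"
        using 2 by (simp add: pos_square_def)
      then show False
        using s by (simp add: plateau_def pos_square_eq_0_iff)
    qed
  qed
  then show "\<exists>a>0. \<exists>b. \<forall>s. plateau s \<noteq> 0 \<longrightarrow> a \<le> s \<and> s \<le> b"
    by (intro exI[of _ "1/2"] exI[of _ 5] conjI) auto
qed

definition C1_punctured :: "('a::euclidean_space \<Rightarrow> real) \<Rightarrow> ('a \<Rightarrow> 'a) \<Rightarrow> bool" where
  "C1_punctured f g \<longleftrightarrow>
     (\<forall>x. x \<noteq> 0 \<longrightarrow> (f has_derivative (\<lambda>h. g x \<bullet> h)) (at x)) \<and> continuous_on (- {0}) g"

lemma C1_punctured_deriv:
  "C1_punctured f g \<Longrightarrow> x \<noteq> 0 \<Longrightarrow> (f has_derivative (\<lambda>h. g x \<bullet> h)) (at x)"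
  unfolding C1_punctured_def by simp

lemma C1_punctured_gradient_continuous: "C1_punctured f g \<Longrightarrow> continuous_on (- {0}) g"
  unfolding C1_punctured_def by simp

lemma C1_punctured_continuous: "C1_punctured f g \<Longrightarrow> continuous_on (- {0}) f"
  unfolding C1_punctured_def
  by (rule continuous_at_imp_continuous_on) (use has_derivative_continuous in blast)

lemma C1_punctured_mult:
  assumes f: "C1_punctured f g" and \<phi>: "C1_punctured \<phi> \<gamma>"
  shows "C1_punctured (\<lambda>x. f x * \<phi> x) (\<lambda>x. \<phi> x *\<^sub>R g x + f x *\<^sub>R \<gamma> x)"
proof -
  have "continuous_on (- {0}) (\<lambda>x. \<phi> x *\<^sub>R g x + f x *\<^sub>R \<gamma> x)"
    using f \<phi> by (intro continuous_intros C1_punctured_continuous[OF f] C1_punctured_continuous[OF \<phi>])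
      (auto simp: C1_punctured_def)
  then show ?thesis
    using f \<phi> unfolding C1_punctured_def
    by (auto intro!: derivative_eq_intros simp: algebra_simps)
qed

lemma C1_punctured_inverse:
  assumes f: "C1_punctured f g" and nz: "\<And>x. x \<noteq> 0 \<Longrightarrow> f x \<noteq> 0"
  shows "C1_punctured (\<lambda>x. 1 / f x) (\<lambda>x. (- 1 / (f x)\<^sup>2) *\<^sub>R g x)"
proof -
  have "continuous_on (- {0}) (\<lambda>x. (- 1 / (f x)\<^sup>2) *\<^sub>R g x)"
    using f nz by (intro continuous_intros C1_punctured_continuous[OF f])
      (auto simp: C1_punctured_def)
  then show ?thesis
    using f nz unfolding C1_punctured_def
    by (auto intro!: derivative_eq_intros simp: field_simps power2_eq_square)
qed

lemma C1_compact_radial_cutoff: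
  fixes f :: "'a::euclidean_space \<Rightarrow> real"
  assumes \<zeta>: "cutoff \<zeta> \<zeta>'"
    and f: "C1_punctured f g"
  shows "C1_compact (\<lambda>x. \<zeta> (x \<bullet> x) * f x)
    (\<lambda>x. \<zeta> (x \<bullet> x) *\<^sub>R g x + (2 * \<zeta>' (x \<bullet> x) * f x) *\<^sub>R x)" (is "C1_compact ?F ?G")
proof -
  have der: "(f has_derivative (\<lambda>h. g x \<bullet> h)) (at x)" if "x \<noteq> 0" for x
    using f that by (simp add: C1_punctured_def)
  have cont: "continuous_on (- {0}) g"
    using f by (simp add: C1_punctured_def)
  obtain a b where a: "a > 0" and ab: "\<And>s. \<zeta> s \<noteq> 0 \<Longrightarrow> a \<le> s \<and> s \<le> b"
    using \<zeta> unfolding cutoff_def by blast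
  have d\<zeta>: "\<And>s. (\<zeta> has_real_derivative \<zeta>' s) (at s)" and c\<zeta>': "continuous_on UNIV \<zeta>'"
    using \<zeta> unfolding cutoff_def by auto
  have c\<zeta>: "continuous_on UNIV \<zeta>"
    using d\<zeta> by (meson DERIV_isCont continuous_at_imp_continuous_on)
  have \<zeta>0: "\<zeta> s = 0" if "s < a" for s
    using ab that by force
  have \<zeta>'0: "\<zeta>' s = 0" if "s < a" for s
  proof -
    have "((\<lambda>s. 0) has_real_derivative 0) (at s)"
      by simp
    then have "(\<zeta> has_real_derivative 0) (at s)"
      by (rule has_field_derivative_transform_within_open[of _ _ _ "{..<a}"])
        (use \<zeta>0 that in auto)
    then show ?thesis
      using d\<zeta> DERIV_unique by blast
  qed
  define B where "B = {x::'a. x \<bullet> x < a}"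
  have oB: "open B"
    unfolding B_def by (intro open_Collect_less continuous_intros)
  have F0: "?F x = 0" and G0: "?G x = 0" if "x \<in> B" for x
    using \<zeta>0 \<zeta>'0 that by (auto simp: B_def)
  have d: "(?F has_derivative (\<lambda>h. ?G x \<bullet> h)) (at x)" for x
  proof (cases "x \<in> B")
    case True
    have "(?F has_derivative (\<lambda>h. 0)) (at x)"
      by (rule has_derivative_transform_within_open[OF has_derivative_const[of 0] oB True])
        (use F0 in auto)
    then show ?thesis
      using G0[OF True] by simp
  next
    case False
    then have "x \<noteq> 0"
      using a by (auto simp: B_def)
    have "((\<lambda>x. x \<bullet> x) has_derivative (\<lambda>h. 2 * (x \<bullet> h))) (at x)"
      by (auto intro!: derivative_eq_intros simp: inner_commute)
    from has_derivative_compose[OF this, of \<zeta> "\<lambda>h. \<zeta>' (x \<bullet> x) * h"]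
    have "((\<lambda>x. \<zeta> (x \<bullet> x)) has_derivative (\<lambda>h. \<zeta>' (x \<bullet> x) * (2 * (x \<bullet> h)))) (at x)"
      using d\<zeta>[of "x \<bullet> x"] by (simp add: has_field_derivative_def)
    from has_derivative_mult[OF this der[OF \<open>x \<noteq> 0\<close>]] show ?thesis
      by (simp add: inner_add_left algebra_simps)
  qed
  have "continuous_on (B \<union> - {0}) ?G"
  proof (rule continuous_on_open_Un)
    show "continuous_on B ?G"
      using G0 by (simp cong: continuous_on_cong)
    show "continuous_on (- {0}) ?G"
      by (intro continuous_intros cont C1_punctured_continuous[OF f] continuous_on_compose2[OF c\<zeta>] continuous_on_compose2[OF c\<zeta>']) auto
  qed (use oB in auto)
  moreover have "B \<union> - {0} = UNIV"
    using a by (auto simp: B_def)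
  moreover have "bounded {x. ?F x \<noteq> 0}"
  proof -
    have "norm x \<le> sqrt b" if "?F x \<noteq> 0" for x
      using that ab[of "x \<bullet> x"] by (auto simp: norm_eq_sqrt_inner)
    then show ?thesis
      unfolding bounded_iff by blast
  qed
  ultimately show ?thesis
    using d unfolding C1_compact_def by simp
qed

text \<open>
  The fundamental lemma of the calculus of variations: if \<open>h p \<noteq> 0\<close>, a small bump around \<open>p\<close>
  makes the integrand of one sign.
\<close>

lemma weakly_zero_imp_zero:
  fixes h :: "'a::euclidean_space \<Rightarrow> real"
  assumes h: "continuous_on UNIV h" and \<Omega>: "open \<Omega>" "p \<in> \<Omega>"
    and weak: "\<And>\<phi> \<gamma>. C1_compact \<phi> \<gamma> \<Longrightarrow> (\<And>x. \<phi> x \<noteq> 0 \<Longrightarrow> x \<in> \<Omega>) \<Longrightarrow> (\<integral>x. h x * \<phi> x \<partial>lborel) = 0"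
  shows "h p = 0"
proof (rule ccontr)
  assume "h p \<noteq> 0"
  define \<sigma> where "\<sigma> = sgn (h p)"
  have \<sigma>: "\<sigma> * h p > 0"
    using \<open>h p \<noteq> 0\<close> by (simp add: \<sigma>_def sgn_mult_self_eq mult.commute flip: abs_sgn)
  have "open ({x. \<sigma> * h x > 0} \<inter> \<Omega>)"
    by (intro open_Int \<Omega>(1) open_Collect_less continuous_intros h)
  then obtain \<delta> where \<delta>: "\<delta> > 0" "ball p \<delta> \<subseteq> {x. \<sigma> * h x > 0} \<inter> \<Omega>"
    using \<sigma> \<Omega>(2) by (metis IntI mem_Collect_eq openE)
  define \<phi> where "\<phi> x = pos_square (\<delta>\<^sup>2 - (x - p) \<bullet> (x - p))" for x
  define \<gamma> where "\<gamma> x = (- 4 * max 0 (\<delta>\<^sup>2 - (x - p) \<bullet> (x - p))) *\<^sub>R (x - p)" for x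
  have supp: "x \<in> ball p \<delta>" if "\<phi> x \<noteq> 0" for x
  proof -
    have "(norm (x - p))\<^sup>2 < \<delta>\<^sup>2"
      using that by (simp add: \<phi>_def pos_square_eq_0_iff power2_norm_eq_inner)
    then show ?thesis
      using \<delta>(1) by (simp add: dist_norm norm_minus_commute power2_less_imp_less)
  qed
  have "C1_compact \<phi> \<gamma>"
    unfolding C1_compact_def
  proof (intro conjI allI)
    fix x
    have "((\<lambda>x. \<delta>\<^sup>2 - (x - p) \<bullet> (x - p)) has_derivative (\<lambda>h. - 2 * ((x - p) \<bullet> h))) (at x)"
      by (auto intro!: derivative_eq_intros simp: inner_commute)
    from has_derivative_compose[OF this pos_square_deriv[unfolded has_field_derivative_def]]
    have "(\<phi> has_derivative
        (\<lambda>h. 2 * max 0 (\<delta>\<^sup>2 - (x - p) \<bullet> (x - p)) * (- 2 * ((x - p) \<bullet> h)))) (at x)"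
      unfolding \<phi>_def .
    moreover have "2 * c * (- 2 * ((x - p) \<bullet> h)) = ((- 4 * c) *\<^sub>R (x - p)) \<bullet> h" for c h
      by simp
    ultimately show "(\<phi> has_derivative (\<lambda>h. \<gamma> x \<bullet> h)) (at x)"
      unfolding \<gamma>_def by (simp add: mult.assoc)
    show "continuous_on UNIV \<gamma>"
      unfolding \<gamma>_def by (intro continuous_intros)
    show "bounded {x. \<phi> x \<noteq> 0}"
      by (rule bounded_subset[OF bounded_ball]) (use supp in auto)
  qed
  then have "(\<integral>x. h x * \<phi> x \<partial>lborel) = 0"
    by (rule weak) (use supp \<delta> in auto)
  then have "(\<integral>x. \<sigma> * (h x * \<phi> x) \<partial>lborel) = 0"
    by simp
  then have "\<sigma> * (h p * \<phi> p) = 0"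
  proof (rule continuous_integral_zero_imp_zero[rotated 3])
    show "continuous_on UNIV (\<lambda>x. \<sigma> * (h x * \<phi> x))"
      by (intro continuous_intros h C1_compact_continuous[OF \<open>C1_compact \<phi> \<gamma>\<close>])
    show "bounded {x. \<sigma> * (h x * \<phi> x) \<noteq> 0}"
      by (rule bounded_subset[OF bounded_ball]) (use supp in auto)
    show "0 \<le> \<sigma> * (h x * \<phi> x)" for x
    proof (cases "\<phi> x = 0")
      case False
      then have "\<sigma> * h x > 0"
        using supp \<delta>(2) by blast
      then show ?thesis
        using pos_square_ge_0 by (simp add: \<phi>_def mult.assoc[symmetric])
    qed simp
  qed
  moreover have "\<phi> p \<noteq> 0"
    using \<delta>(1) by (simp add: \<phi>_def pos_square_eq_0_iff)
  ultimately show False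
    using \<sigma> by auto
qed

section \<open>Homogeneous solutions on the punctured space\<close>

text \<open>
  The hypothesis makes \<open>x\<close> orthogonal to the range of \<open>S\<close>, so that \<open>S\<close> and the orthogonal projection
  \<open>P\<close> onto the complement of \<open>x\<close> have inner product \<open>trace S\<close>. As \<open>P\<close> has squared norm \<open>2\<close> in dimension
  three, the inequality says that \<open>S - (trace S / 2) P\<close> has nonnegative squared norm.
\<close>

lemma trace_square_le:
  fixes S :: "'a::euclidean_space \<Rightarrow> 'a"
  assumes dim: "DIM('a) = 3" and x: "x \<noteq> 0" and S: "\<And>h. S h \<bullet> x = 0"
  shows "(\<Sum>i\<in>Basis. S i \<bullet> i)\<^sup>2 \<le> 2 * (\<Sum>i\<in>Basis. S i \<bullet> S i)"
proof -
  let ?s = "x \<bullet> x"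
  define t where "t = (\<Sum>i\<in>Basis. S i \<bullet> i)"
  have s: "?s \<noteq> 0"
    using x by simp
  define D where "D i = S i - (t / 2) *\<^sub>R (i - ((x \<bullet> i) / ?s) *\<^sub>R x)" for i
  have square: "(v - k *\<^sub>R w) \<bullet> (v - k *\<^sub>R w) = v \<bullet> v - 2 * k * (v \<bullet> w) + k * k * (w \<bullet> w)"
    for v w :: 'a and k
    by (simp add: inner_diff_left inner_diff_right inner_commute[of w v] right_diff_distrib)
  have "D i \<bullet> D i = S i \<bullet> S i - t * (S i \<bullet> i) + t\<^sup>2 / 4 * (1 - (x \<bullet> i) * (x \<bullet> i) / ?s)"
    if "i \<in> Basis" for i
  proof -
    let ?p = "i - ((x \<bullet> i) / ?s) *\<^sub>R x"
    have "?p \<bullet> ?p = 1 - (x \<bullet> i) * (x \<bullet> i) / ?s"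
      unfolding square using that s by (simp add: inner_commute[of i x])
    moreover have "S i \<bullet> ?p = S i \<bullet> i"
      using S by (simp add: inner_diff_right)
    ultimately show ?thesis
      unfolding D_def square by (simp add: power2_eq_square)
  qed
  then have "(\<Sum>i\<in>Basis. D i \<bullet> D i) =
      (\<Sum>i\<in>Basis. S i \<bullet> S i - t * (S i \<bullet> i) + t\<^sup>2 / 4 * (1 - (x \<bullet> i) * (x \<bullet> i) / ?s))"
    by (rule sum.cong[OF refl])
  also have "\<dots> = (\<Sum>i\<in>Basis. S i \<bullet> S i) - t * t + t\<^sup>2 / 4 * (3 - (\<Sum>i\<in>Basis. (x \<bullet> i) * (x \<bullet> i)) / ?s)"
    using dim
    by (simp add: sum.distrib sum_subtractf sum_distrib_left[symmetric] sum_divide_distrib[symmetric] t_def)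
  also have "(\<Sum>i\<in>Basis. (x \<bullet> i) * (x \<bullet> i)) = ?s"
    by (rule euclidean_inner[symmetric])
  also have "(\<Sum>i\<in>Basis. S i \<bullet> S i) - t * t + t\<^sup>2 / 4 * (3 - ?s / ?s) = (\<Sum>i\<in>Basis. S i \<bullet> S i) - t\<^sup>2 / 2"
    using s by (simp add: power2_eq_square)
  finally have "(\<Sum>i\<in>Basis. S i \<bullet> S i) - t\<^sup>2 / 2 = (\<Sum>i\<in>Basis. D i \<bullet> D i)" ..
  also have "\<dots> \<ge> 0"
    by (intro sum_nonneg) simp
  finally show ?thesis
    by (simp add: t_def)
qed

text \<open>
  Homogeneity of degree one enters only through Euler's relation for \<open>U\<close>. The constant \<open>c\<close> stands for
  \<open>1 - \<beta>\<close>.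
\<close>

locale homogeneous_solution =
  fixes U :: "'a::euclidean_space \<Rightarrow> real" and G :: "'a \<Rightarrow> 'a" and H :: "'a \<Rightarrow> 'a \<Rightarrow> 'a" and c :: real
  assumes dim: "DIM('a) = 3"
    and c_pos: "c > 0"
    and U_pos: "x \<noteq> 0 \<Longrightarrow> U x > 0"
    and U_deriv: "x \<noteq> 0 \<Longrightarrow> (U has_derivative (\<lambda>h. G x \<bullet> h)) (at x)"
    and G_deriv: "x \<noteq> 0 \<Longrightarrow> (G has_derivative H x) (at x)"
    and H_cont: "continuous_on (- {0}) (\<lambda>x. H x h)"
    and euler: "x \<noteq> 0 \<Longrightarrow> G x \<bullet> x = U x"
    and equation: "x \<noteq> 0 \<Longrightarrow>
      U x * (\<Sum>i\<in>Basis. H x i \<bullet> i) = G x \<bullet> G x + 1 + c * (U x)\<^sup>2 / (x \<bullet> x)"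
begin

text \<open>
  The adjoint of \<open>H x\<close>. Its value at \<open>v\<close> is the gradient of the component \<open>G x \<bullet> v\<close>; that this is
  also \<open>H x v\<close> amounts to the symmetry of second derivatives, proved below.
\<close>

definition H_adj :: "'a \<Rightarrow> 'a \<Rightarrow> 'a" where
  "H_adj x v = (\<Sum>i\<in>Basis. (H x i \<bullet> v) *\<^sub>R i)"

lemma H_adj_inner:
  assumes "x \<noteq> 0"
  shows "H_adj x v \<bullet> h = v \<bullet> H x h"
proof -
  have lin: "linear (H x)"
    using G_deriv[OF assms] by (rule has_derivative_linear)
  have "H x h = H x (\<Sum>i\<in>Basis. (h \<bullet> i) *\<^sub>R i)"
    by (simp add: euclidean_representation)
  also have "\<dots> = (\<Sum>i\<in>Basis. (h \<bullet> i) *\<^sub>R H x i)"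
    by (simp add: linear_sum[OF lin] linear_scale[OF lin])
  finally have "v \<bullet> H x h = (\<Sum>i\<in>Basis. (h \<bullet> i) * (v \<bullet> H x i))"
    by (simp add: inner_sum_right)
  moreover have "H_adj x v \<bullet> h = (\<Sum>i\<in>Basis. (v \<bullet> H x i) * (i \<bullet> h))"
    by (simp add: H_adj_def inner_sum_left inner_commute[of "H x _" v])
  ultimately show ?thesis
    by (simp add: inner_commute[of h] mult.commute)
qed

lemma G_continuous: "continuous_on (- {0}) G"
  by (rule continuous_at_imp_continuous_on) (use has_derivative_continuous[OF G_deriv] in blast)

lemma C1_U: "C1_punctured U G"
  unfolding C1_punctured_def using U_deriv G_continuous by blast

lemma H_adj_continuous: "continuous_on (- {0}) v \<Longrightarrow> continuous_on (- {0}) (\<lambda>x. H_adj x (v x))"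
  unfolding H_adj_def by (intro continuous_intros H_cont)

lemma C1_G: "C1_punctured (\<lambda>x. G x \<bullet> v) (\<lambda>x. H_adj x v)"
proof -
  have "((\<lambda>x. G x \<bullet> v) has_derivative (\<lambda>h. H_adj x v \<bullet> h)) (at x)" if "x \<noteq> 0" for x
    using has_derivative_inner_left[OF G_deriv[OF that], of v]
    unfolding H_adj_inner[OF that] by (simp only: inner_commute[of "H x _" v])
  then show ?thesis
    unfolding C1_punctured_def using H_adj_continuous by (auto intro: continuous_intros)
qed

lemma C1_square: "C1_punctured (\<lambda>x::'a. x \<bullet> x) (\<lambda>x. 2 *\<^sub>R x)"
  unfolding C1_punctured_def
  by (auto intro!: derivative_eq_intros continuous_intros simp: inner_commute)

lemma C1_coordinate: "C1_punctured (\<lambda>x::'a. x \<bullet> v) (\<lambda>x. v)"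
  unfolding C1_punctured_def
  by (auto intro!: derivative_eq_intros continuous_intros simp: inner_commute)

text \<open>
  The trace of \<open>H\<close>, written by means of the equation in terms of first derivatives of \<open>U\<close>. In this form
  it is visibly of class \<open>C\<^sup>1\<close>, with gradient \<open>Q'\<close>.
\<close>

definition Q :: "'a \<Rightarrow> real" where
  "Q x = (G x \<bullet> G x + 1 + c * (U x)\<^sup>2 / (x \<bullet> x)) / U x"

definition Q' :: "'a \<Rightarrow> 'a" where
  "Q' x = (1 / U x) *\<^sub>R (2 *\<^sub>R H_adj x (G x) + c *\<^sub>R ((1 / (x \<bullet> x)) *\<^sub>R (U x *\<^sub>R G x + U x *\<^sub>R G x)
        + (U x * U x) *\<^sub>R (- 1 / (x \<bullet> x)\<^sup>2) *\<^sub>R 2 *\<^sub>R x))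
      + (G x \<bullet> G x + 1 + c * (U x * U x * (1 / (x \<bullet> x)))) *\<^sub>R (- 1 / (U x)\<^sup>2) *\<^sub>R G x"

lemma trace_eq_Q: "x \<noteq> 0 \<Longrightarrow> (\<Sum>i\<in>Basis. H x i \<bullet> i) = Q x"
  using equation[of x] U_pos[of x] by (simp add: Q_def field_simps)

lemma C1_Q: "C1_punctured Q Q'"
proof -
  let ?r = "\<lambda>x. U x * U x * (1 / (x \<bullet> x))"
  let ?r' = "\<lambda>x. (1 / (x \<bullet> x)) *\<^sub>R (U x *\<^sub>R G x + U x *\<^sub>R G x) + (U x * U x) *\<^sub>R (- 1 / (x \<bullet> x)\<^sup>2) *\<^sub>R 2 *\<^sub>R x"
  have r: "C1_punctured ?r ?r'"
    by (rule C1_punctured_mult[OF C1_punctured_mult[OF C1_U C1_U] C1_punctured_inverse[OF C1_square]]) simp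
  have "C1_punctured (\<lambda>x. G x \<bullet> G x + 1 + c * ?r x) (\<lambda>x. 2 *\<^sub>R H_adj x (G x) + c *\<^sub>R ?r' x)"
    unfolding C1_punctured_def
  proof (intro conjI allI impI)
    fix x :: 'a assume x: "x \<noteq> 0"
    have "((\<lambda>x. G x \<bullet> G x) has_derivative (\<lambda>h. G x \<bullet> H x h + H x h \<bullet> G x)) (at x)"
      by (rule has_derivative_inner[OF G_deriv[OF x] G_deriv[OF x]])
    then have 1: "((\<lambda>x. G x \<bullet> G x) has_derivative (\<lambda>h. (2 *\<^sub>R H_adj x (G x)) \<bullet> h)) (at x)"
      by (simp add: H_adj_inner[OF x] inner_commute[of "H x _"])
    have 2: "((\<lambda>x. c * ?r x) has_derivative (\<lambda>h. c * (?r' x \<bullet> h))) (at x)"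
      by (rule has_derivative_mult_right[OF C1_punctured_deriv[OF r x]])
    show "((\<lambda>x. G x \<bullet> G x + 1 + c * ?r x) has_derivative
        (\<lambda>h. (2 *\<^sub>R H_adj x (G x) + c *\<^sub>R ?r' x) \<bullet> h)) (at x)"
      using has_derivative_add[OF has_derivative_add[OF 1 has_derivative_const[of 1]] 2]
      unfolding inner_add_left[of "2 *\<^sub>R H_adj x (G x)"] inner_scaleR_left[of c] add_0_right .
  next
    show "continuous_on (- {0}) (\<lambda>x. 2 *\<^sub>R H_adj x (G x) + c *\<^sub>R ?r' x)"
      by (intro continuous_on_add[OF continuous_on_scaleR continuous_on_scaleR] continuous_on_const
          H_adj_continuous G_continuous C1_punctured_gradient_continuous[OF r])
  qed
  moreover have "C1_punctured (\<lambda>x. 1 / U x) (\<lambda>x. (- 1 / (U x)\<^sup>2) *\<^sub>R G x)"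
    by (rule C1_punctured_inverse[OF C1_U]) (use U_pos in force)
  ultimately have "C1_punctured (\<lambda>x. (G x \<bullet> G x + 1 + c * ?r x) * (1 / U x)) Q'"
    unfolding Q'_def[abs_def] by (rule C1_punctured_mult)
  moreover have "(\<lambda>x. (G x \<bullet> G x + 1 + c * ?r x) * (1 / U x)) = Q"
    by (rule ext) (simp add: Q_def power2_eq_square)
  ultimately show ?thesis
    by simp
qed

lemma Q'_inner:
  assumes "x \<noteq> 0"
  shows "Q' x \<bullet> v = (2 * (G x \<bullet> H x v) + 2 * c * U x / (x \<bullet> x) * (G x \<bullet> v)
      - 2 * c * (U x)\<^sup>2 / (x \<bullet> x)\<^sup>2 * (x \<bullet> v) - Q x * (G x \<bullet> v)) / U x"
proof -
  have algebra: "1 / u * (2 * A + c * (1 / s * (u * B + u * B) + u * u * (- 1 / s\<^sup>2 * (2 * D)))) + N * (- 1 / u\<^sup>2 * B)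
      = (2 * A + 2 * c * u / s * B - 2 * c * u\<^sup>2 / s\<^sup>2 * D - N / u * B) / u"
    if "u \<noteq> 0" "s \<noteq> 0" for u s A B D N :: real
    using that by (simp add: field_simps power2_eq_square)
  have Q: "Q x = (G x \<bullet> G x + 1 + c * (U x * U x * (1 / (x \<bullet> x)))) / U x"
    by (simp add: Q_def power2_eq_square)
  show ?thesis
    unfolding Q'_def inner_add_left inner_scaleR_left H_adj_inner[OF assms] Q
    by (rule algebra) (use assms U_pos[OF assms] in auto)
qed

text \<open>
  Schwarz's theorem, in weak form: two integrations by parts of the vanishing minor of the gradients of
  \<open>U\<close> and a test function \<open>\<phi>\<close> show that \<open>\<partial>\<^sub>b \<partial>\<^sub>a U - \<partial>\<^sub>a \<partial>\<^sub>b U\<close> is orthogonal to every \<open>\<phi>\<close> supported in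
  the shell \<open>1 < \<bar>x\<bar>\<^sup>2 < 4\<close>. The cutoff \<^term>\<open>plateau\<close> makes \<open>U\<close> and its derivatives compactly supported without changing
  them in the shell.
\<close>

lemma Hessian_symmetric:
  assumes p: "1 < p \<bullet> p" "p \<bullet> p < 4"
  shows "a \<bullet> H p b = b \<bullet> H p a"
proof -
  define F' where "F' x = plateau (x \<bullet> x) *\<^sub>R G x + (2 * plateau' (x \<bullet> x) * U x) *\<^sub>R x" for x
  define Z where "Z v x = plateau (x \<bullet> x) * (G x \<bullet> v)" for v x
  define Z_grad where "Z_grad v x = plateau (x \<bullet> x) *\<^sub>R H_adj x v + (2 * plateau' (x \<bullet> x) * (G x \<bullet> v)) *\<^sub>R x" for v x
  have F: "C1_compact (\<lambda>x. plateau (x \<bullet> x) * U x) F'"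
    unfolding F'_def by (rule C1_compact_radial_cutoff[OF cutoff_plateau C1_U])
  have Z: "C1_compact (Z v) (Z_grad v)" for v
    unfolding Z_def[abs_def] Z_grad_def[abs_def] by (rule C1_compact_radial_cutoff[OF cutoff_plateau C1_G])
  let ?\<Omega> = "{x::'a. 1 < x \<bullet> x \<and> x \<bullet> x < 4}"
  have "Z_grad a p \<bullet> b - Z_grad b p \<bullet> a = 0"
  proof (rule weakly_zero_imp_zero[where \<Omega> = ?\<Omega> and h = "\<lambda>x. Z_grad a x \<bullet> b - Z_grad b x \<bullet> a"])
    show "continuous_on UNIV (\<lambda>x. Z_grad a x \<bullet> b - Z_grad b x \<bullet> a)"
      by (intro continuous_intros C1_compact_gradient_continuous[OF Z])
    show "open ?\<Omega>"
      by (intro open_Collect_conj open_Collect_less continuous_intros)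
    fix \<phi> :: "'a \<Rightarrow> real" and \<gamma> assume \<phi>: "C1_compact \<phi> \<gamma>" and supp: "\<And>x. \<phi> x \<noteq> 0 \<Longrightarrow> x \<in> ?\<Omega>"
    have \<gamma>: "1 \<le> x \<bullet> x \<and> x \<bullet> x \<le> 4" if "\<gamma> x \<noteq> 0" for x
    proof (rule ccontr)
      assume "\<not> ?thesis"
      then have "x \<in> {x. x \<bullet> x < 1} \<union> {x. 4 < x \<bullet> x}"
        by auto
      moreover have "open ({x::'a. x \<bullet> x < 1} \<union> {x. 4 < x \<bullet> x})"
        by (intro open_Un open_Collect_less continuous_intros)
      moreover have "\<phi> y = 0" if "y \<in> {x. x \<bullet> x < 1} \<union> {x. 4 < x \<bullet> x}" for y
        using supp[of y] that by force
      ultimately have "\<gamma> x = 0"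
        by (intro C1_compact_gradient_zero_on_open[OF \<phi>])
      then show False using that by simp
    qed
    have *: "(\<integral>x. (F' x \<bullet> a) * (\<gamma> x \<bullet> b) \<partial>lborel) = - (\<integral>x. (Z_grad a x \<bullet> b) * \<phi> x \<partial>lborel)" for a b
    proof -
      have "(\<lambda>x. (F' x \<bullet> a) * (\<gamma> x \<bullet> b)) = (\<lambda>x. Z a x * (\<gamma> x \<bullet> b))"
      proof
        show "(F' x \<bullet> a) * (\<gamma> x \<bullet> b) = Z a x * (\<gamma> x \<bullet> b)" for x
          using \<gamma>[of x] plateau_inside[of "x \<bullet> x"] by (cases "\<gamma> x = 0") (auto simp: F'_def Z_def)
      qed
      then show ?thesis
        using integral_by_parts[OF Z \<phi>] by (simp only:)
    qed
    have I: "integrable lborel (\<lambda>x. (Z_grad a x \<bullet> b) * \<phi> x)" for a b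
      by (rule integrable_gradient_mult_continuous[OF Z C1_compact_continuous[OF \<phi>]])
    show "(\<integral>x. (Z_grad a x \<bullet> b - Z_grad b x \<bullet> a) * \<phi> x \<partial>lborel) = 0"
      using integral_gradient_minor_zero[OF F \<phi>, of a b] *[of a b] *[of b a] I[of a b] I[of b a]
      by (simp add: left_diff_distrib)
  qed (use p in simp)
  moreover have "Z_grad v p = H_adj p v" for v
    using plateau_inside[of "p \<bullet> p"] p by (simp add: Z_grad_def)
  moreover have "p \<noteq> 0"
    using p by auto
  ultimately show ?thesis
    by (simp add: H_adj_inner)
qed

text \<open>
  Differentiation of Euler's relation \<open>G x \<bullet> x = U x\<close>.
\<close>

lemma Hessian_radial:
  assumes "x \<noteq> 0"
  shows "H x h \<bullet> x = 0"
proof -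
  have "((\<lambda>x. G x \<bullet> x) has_derivative (\<lambda>h. G x \<bullet> h + H x h \<bullet> x)) (at x)"
    by (rule has_derivative_inner[OF G_deriv[OF assms] has_derivative_ident])
  then have "(U has_derivative (\<lambda>h. G x \<bullet> h + H x h \<bullet> x)) (at x)"
    by (rule has_derivative_transform_within_open[where s = "- {0}"]) (use assms euler in auto)
  then have "(\<lambda>h. G x \<bullet> h + H x h \<bullet> x) = (\<lambda>h. G x \<bullet> h)"
    by (rule has_derivative_unique[OF _ U_deriv[OF assms]])
  then have "G x \<bullet> h + H x h \<bullet> x = G x \<bullet> h"
    by (rule fun_cong)
  then show ?thesis by simp
qed

text \<open>
  The gradients of the four families of compactly supported functions to which the integral lemmas are
  applied: the localized first derivatives \<open>\<partial>\<^sub>j U\<close>, their quotients by \<open>U\<close>, and the components of the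
  vector fields \<open>Q G / U\<close> and \<open>Q x / \<bar>x\<bar>\<^sup>2\<close>. The last three are cut off by \<^term>\<open>bump\<close>.
\<close>

definition Z_grad :: "'a \<Rightarrow> 'a \<Rightarrow> 'a" where
  "Z_grad j x = plateau (x \<bullet> x) *\<^sub>R H_adj x j + (2 * plateau' (x \<bullet> x) * (G x \<bullet> j)) *\<^sub>R x"

definition \<Phi>_grad :: "'a \<Rightarrow> 'a \<Rightarrow> 'a" where
  "\<Phi>_grad i x = bump (x \<bullet> x) *\<^sub>R ((1 / U x) *\<^sub>R H_adj x i + (G x \<bullet> i) *\<^sub>R (- 1 / (U x)\<^sup>2) *\<^sub>R G x)
     + (2 * bump' (x \<bullet> x) * ((G x \<bullet> i) * (1 / U x))) *\<^sub>R x"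

definition \<Psi>_grad :: "'a \<Rightarrow> 'a \<Rightarrow> 'a" where
  "\<Psi>_grad i x = bump (x \<bullet> x) *\<^sub>R (((G x \<bullet> i) * (1 / U x)) *\<^sub>R Q' x
        + Q x *\<^sub>R ((1 / U x) *\<^sub>R H_adj x i + (G x \<bullet> i) *\<^sub>R (- 1 / (U x)\<^sup>2) *\<^sub>R G x))
     + (2 * bump' (x \<bullet> x) * (Q x * ((G x \<bullet> i) * (1 / U x)))) *\<^sub>R x"

definition \<Xi>_grad :: "'a \<Rightarrow> 'a \<Rightarrow> 'a" where
  "\<Xi>_grad i x = bump (x \<bullet> x) *\<^sub>R ((Q x * (1 / (x \<bullet> x))) *\<^sub>R i
        + (x \<bullet> i) *\<^sub>R ((1 / (x \<bullet> x)) *\<^sub>R Q' x + Q x *\<^sub>R (- 1 / (x \<bullet> x)\<^sup>2) *\<^sub>R 2 *\<^sub>R x))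
     + (2 * bump' (x \<bullet> x) * ((x \<bullet> i) * (Q x * (1 / (x \<bullet> x))))) *\<^sub>R x"

lemma C1_inverse_U: "C1_punctured (\<lambda>x. 1 / U x) (\<lambda>x. (- 1 / (U x)\<^sup>2) *\<^sub>R G x)"
  by (rule C1_punctured_inverse[OF C1_U]) (use U_pos in force)

lemma C1_inverse_square:
  "C1_punctured (\<lambda>x::'a. 1 / (x \<bullet> x)) (\<lambda>x. (- 1 / (x \<bullet> x)\<^sup>2) *\<^sub>R 2 *\<^sub>R x)"
  by (rule C1_punctured_inverse[OF C1_square]) simp

lemma C1_compact_Z: "C1_compact (\<lambda>x. plateau (x \<bullet> x) * (G x \<bullet> j)) (Z_grad j)"
  unfolding Z_grad_def[abs_def] by (rule C1_compact_radial_cutoff[OF cutoff_plateau C1_G])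

lemma C1_compact_\<Phi>: "C1_compact (\<lambda>x. bump (x \<bullet> x) * ((G x \<bullet> i) * (1 / U x))) (\<Phi>_grad i)"
  unfolding \<Phi>_grad_def[abs_def]
  by (rule C1_compact_radial_cutoff[OF cutoff_bump C1_punctured_mult[OF C1_G C1_inverse_U]])

lemma C1_compact_\<Psi>: "C1_compact (\<lambda>x. bump (x \<bullet> x) * (Q x * ((G x \<bullet> i) * (1 / U x)))) (\<Psi>_grad i)"
  unfolding \<Psi>_grad_def[abs_def]
  by (rule C1_compact_radial_cutoff[OF cutoff_bump
        C1_punctured_mult[OF C1_Q C1_punctured_mult[OF C1_G C1_inverse_U]]])

lemma C1_compact_\<Xi>: "C1_compact (\<lambda>x. bump (x \<bullet> x) * ((x \<bullet> i) * (Q x * (1 / (x \<bullet> x))))) (\<Xi>_grad i)"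
  unfolding \<Xi>_grad_def[abs_def]
  by (rule C1_compact_radial_cutoff[OF cutoff_bump
        C1_punctured_mult[OF C1_coordinate C1_punctured_mult[OF C1_Q C1_inverse_square]]])

text \<open>
  The Bochner divergence in a form that needs no third derivatives: the minors replace
  \<open>div (H G / U) - div (Q G / U)\<close>, the second sum restores half of \<open>div (Q G / U)\<close>, and the third sum
  cancels the radial boundary term which the cutoff creates.
\<close>

definition bochner :: "'a \<Rightarrow> real" where
  "bochner x = (\<Sum>i\<in>Basis. \<Sum>j\<in>Basis. (Z_grad j x \<bullet> i) * (\<Phi>_grad i x \<bullet> j) - (Z_grad j x \<bullet> j) * (\<Phi>_grad i x \<bullet> i))
     + (\<Sum>i\<in>Basis. \<Psi>_grad i x \<bullet> i) / 2 + (\<Sum>i\<in>Basis. \<Xi>_grad i x \<bullet> i) / 2"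

lemma bochner_continuous: "continuous_on UNIV bochner"
  unfolding bochner_def
  by (intro continuous_intros C1_compact_gradient_continuous[OF C1_compact_Z]
      C1_compact_gradient_continuous[OF C1_compact_\<Phi>] C1_compact_gradient_continuous[OF C1_compact_\<Psi>]
      C1_compact_gradient_continuous[OF C1_compact_\<Xi>]) auto

lemma bochner_integral: "(\<integral>x. bochner x \<partial>lborel) = 0"
proof -
  have I1: "integrable lborel (\<lambda>x. (Z_grad j x \<bullet> a) * (\<Phi>_grad i x \<bullet> b))" for i j a b
    by (intro integrable_gradient_mult_continuous[OF C1_compact_Z] continuous_intros
        C1_compact_gradient_continuous[OF C1_compact_\<Phi>])
  have I2: "integrable lborel (\<lambda>x. \<Psi>_grad i x \<bullet> i)" for i
    using integrable_gradient_mult_continuous[OF C1_compact_\<Psi>, of "\<lambda>_. 1"] by simp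
  have I3: "integrable lborel (\<lambda>x. \<Xi>_grad i x \<bullet> i)" for i
    using integrable_gradient_mult_continuous[OF C1_compact_\<Xi>, of "\<lambda>_. 1"] by simp
  have "(\<integral>x. (\<Sum>i\<in>Basis. \<Sum>j\<in>Basis. (Z_grad j x \<bullet> i) * (\<Phi>_grad i x \<bullet> j) - (Z_grad j x \<bullet> j) * (\<Phi>_grad i x \<bullet> i)) \<partial>lborel) = 0"
    using I1 integral_gradient_minor_zero[OF C1_compact_Z C1_compact_\<Phi>]
    by (simp add: Bochner_Integration.integral_sum Bochner_Integration.integral_diff)
  moreover have "(\<integral>x. (\<Sum>i\<in>Basis. \<Psi>_grad i x \<bullet> i) / 2 \<partial>lborel) = 0"
    using I2 integral_directional_derivative_zero[OF C1_compact_\<Psi>]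
    by (simp add: Bochner_Integration.integral_sum)
  moreover have "(\<integral>x. (\<Sum>i\<in>Basis. \<Xi>_grad i x \<bullet> i) / 2 \<partial>lborel) = 0"
    using I3 integral_directional_derivative_zero[OF C1_compact_\<Xi>]
    by (simp add: Bochner_Integration.integral_sum)
  ultimately show ?thesis
    unfolding bochner_def using I1 I2 I3
    by (simp add: Bochner_Integration.integral_add)
qed

lemma bochner_outside: "\<not> (1 < x \<bullet> x \<and> x \<bullet> x < 4) \<Longrightarrow> bochner x = 0"
  using bump_outside[of "x \<bullet> x"] by (simp add: bochner_def \<Phi>_grad_def \<Psi>_grad_def \<Xi>_grad_def)

text \<open>
  The terms in \<open>H G \<bullet> G\<close> and \<open>Q \<bar>G\<bar>\<^sup>2\<close> cancel by the formula for the gradient of \<open>Q\<close>, and the terms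
  containing \<open>bump'\<close> cancel because \<open>H x x = 0\<close> and \<open>G x \<bullet> x = U x\<close>.
\<close>

lemma bochner_formula:
  assumes x: "1 < x \<bullet> x" "x \<bullet> x < 4"
  shows "bochner x = bump (x \<bullet> x) / U x * ((\<Sum>i\<in>Basis. H x i \<bullet> H x i) - (Q x)\<^sup>2 / 2
     + c / (x \<bullet> x) * (G x \<bullet> G x - (U x)\<^sup>2 / (x \<bullet> x)))"
proof -
  have x0: "x \<noteq> 0"
    using x by auto
  have sym: "a \<bullet> H x b = b \<bullet> H x a" for a b
    by (rule Hessian_symmetric[OF x])
  define s u q g \<eta> \<eta>' where "s = x \<bullet> x" and "u = U x" and "q = Q x" and "g = G x"
    and "\<eta> = bump s" and "\<eta>' = bump' s"
  note defs = s_def u_def q_def g_def \<eta>_def \<eta>'_def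
  have su: "s > 0" "u > 0" "s \<noteq> 0" "u \<noteq> 0"
    using x U_pos[OF x0] by (auto simp: defs)
  have gx: "g \<bullet> x = u" "x \<bullet> g = u"
    using euler[OF x0] by (auto simp: defs inner_commute)
  have Hx: "H x h \<bullet> x = 0" "x \<bullet> H x h = 0" "H x x = 0" for h
  proof -
    show *: "H x h \<bullet> x = 0" "x \<bullet> H x h = 0" for h
      using Hessian_radial[OF x0] by (simp_all add: inner_commute)
    have "H x x \<bullet> H x x = x \<bullet> H x (H x x)"
      by (rule sym)
    then show "H x x = 0"
      using * by simp
  qed
  have tr: "(\<Sum>i\<in>Basis. i \<bullet> H x i) = q"
    using trace_eq_Q[OF x0] by (simp add: defs inner_commute)
  have Z: "Z_grad j x \<bullet> a = j \<bullet> H x a" for j a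
    using plateau_inside[of "x \<bullet> x"] x by (simp add: Z_grad_def H_adj_inner[OF x0])
  have \<Phi>: "\<Phi>_grad i x \<bullet> a = \<eta> / u * (i \<bullet> H x a) - \<eta> / u\<^sup>2 * ((g \<bullet> i) * (g \<bullet> a)) + 2 * \<eta>' / u * ((g \<bullet> i) * (x \<bullet> a))"
    for i a
    unfolding \<Phi>_grad_def inner_add_left inner_scaleR_left H_adj_inner[OF x0] defs[symmetric]
    by (simp add: algebra_simps)
  have Hgg: "(\<Sum>i\<in>Basis. \<Sum>j\<in>Basis. (j \<bullet> H x i) * ((g \<bullet> i) * (g \<bullet> j))) = g \<bullet> H x g"
  proof -
    have "(\<Sum>j\<in>Basis. (j \<bullet> H x i) * ((g \<bullet> i) * (g \<bullet> j))) = (g \<bullet> i) * (H x g \<bullet> i)" for i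
    proof -
      have "(\<Sum>j\<in>Basis. (j \<bullet> H x i) * ((g \<bullet> i) * (g \<bullet> j))) = (g \<bullet> i) * (\<Sum>j\<in>Basis. (g \<bullet> j) * (H x i \<bullet> j))"
        unfolding sum_distrib_left by (rule sum.cong) (auto simp: inner_commute)
      also have "(\<Sum>j\<in>Basis. (g \<bullet> j) * (H x i \<bullet> j)) = g \<bullet> H x i"
        by (rule euclidean_inner[symmetric])
      finally show ?thesis
        using sym[of g i] by (simp add: inner_commute)
    qed
    then show ?thesis
      by (simp add: euclidean_inner[of g "H x g"])
  qed
  have Hgx: "(\<Sum>i\<in>Basis. \<Sum>j\<in>Basis. (j \<bullet> H x i) * ((g \<bullet> i) * (x \<bullet> j))) = 0"
  proof -
    have "(\<Sum>j\<in>Basis. (j \<bullet> H x i) * ((g \<bullet> i) * (x \<bullet> j))) = (g \<bullet> i) * (\<Sum>j\<in>Basis. (x \<bullet> j) * (H x i \<bullet> j))" for i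
      unfolding sum_distrib_left by (rule sum.cong) (auto simp: inner_commute)
    then show ?thesis
      using Hx by (simp add: euclidean_inner[of x, symmetric])
  qed
  have HH: "(\<Sum>i\<in>Basis. \<Sum>j\<in>Basis. (j \<bullet> H x i) * (i \<bullet> H x j)) = (\<Sum>i\<in>Basis. H x i \<bullet> H x i)"
  proof (rule sum.cong[OF refl])
    fix i
    have "(\<Sum>j\<in>Basis. (j \<bullet> H x i) * (i \<bullet> H x j)) = (\<Sum>j\<in>Basis. (H x i \<bullet> j) * (H x i \<bullet> j))"
      by (rule sum.cong) (auto simp: sym[of i] inner_commute)
    then show "(\<Sum>j\<in>Basis. (j \<bullet> H x i) * (i \<bullet> H x j)) = H x i \<bullet> H x i"
      by (simp add: euclidean_inner[symmetric])
  qed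
  have S1: "(\<Sum>i\<in>Basis. \<Sum>j\<in>Basis. (Z_grad j x \<bullet> i) * (\<Phi>_grad i x \<bullet> j)) =
      \<eta> / u * (\<Sum>i\<in>Basis. H x i \<bullet> H x i) - \<eta> / u\<^sup>2 * (g \<bullet> H x g)"
  proof -
    have "(\<Sum>i\<in>Basis. \<Sum>j\<in>Basis. (Z_grad j x \<bullet> i) * (\<Phi>_grad i x \<bullet> j)) =
      (\<Sum>i\<in>Basis. \<Sum>j\<in>Basis. \<eta> / u * ((j \<bullet> H x i) * (i \<bullet> H x j))
         - \<eta> / u\<^sup>2 * ((j \<bullet> H x i) * ((g \<bullet> i) * (g \<bullet> j)))
         + 2 * \<eta>' / u * ((j \<bullet> H x i) * ((g \<bullet> i) * (x \<bullet> j))))"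
      unfolding Z \<Phi> by (intro sum.cong refl) (simp add: algebra_simps)
    then show ?thesis
      by (simp only: sum.distrib sum_subtractf sum_distrib_left[symmetric] HH Hgg Hgx)
  qed
  have gg: "(\<Sum>i\<in>Basis. (g \<bullet> i) * (v \<bullet> i)) = g \<bullet> v" for v
    by (rule euclidean_inner[symmetric])
  have tr\<Phi>: "(\<Sum>i\<in>Basis. \<Phi>_grad i x \<bullet> i) = \<eta> / u * q - \<eta> / u\<^sup>2 * (g \<bullet> g) + 2 * \<eta>'"
    unfolding \<Phi> sum.distrib sum_subtractf sum_distrib_left[symmetric] gg tr
    using su gx by simp
  have S2: "(\<Sum>i\<in>Basis. \<Sum>j\<in>Basis. (Z_grad j x \<bullet> j) * (\<Phi>_grad i x \<bullet> i)) =
      q * (\<eta> / u * q - \<eta> / u\<^sup>2 * (g \<bullet> g) + 2 * \<eta>')"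
    unfolding Z sum_distrib_right[symmetric] tr sum_distrib_left[symmetric] tr\<Phi> ..
  have Q': "Q' x \<bullet> v = (2 * (g \<bullet> H x v) + 2 * c * u / s * (g \<bullet> v) - 2 * c * u\<^sup>2 / s\<^sup>2 * (x \<bullet> v) - q * (g \<bullet> v)) / u" for v
    unfolding defs by (rule Q'_inner[OF x0])
  have Q'x: "Q' x \<bullet> x = - q"
    unfolding Q' Hx gx s_def[symmetric] using su by (simp add: power2_eq_square)
  have S3: "(\<Sum>i\<in>Basis. \<Psi>_grad i x \<bullet> i) = \<eta> / u * (Q' x \<bullet> g)
      + q * (\<eta> / u * q - \<eta> / u\<^sup>2 * (g \<bullet> g) + 2 * \<eta>')"
  proof -
    have "\<Psi>_grad i x \<bullet> i = \<eta> / u * ((g \<bullet> i) * (Q' x \<bullet> i)) + q * (\<Phi>_grad i x \<bullet> i)" for i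
      unfolding \<Psi>_grad_def \<Phi> inner_add_left inner_scaleR_left H_adj_inner[OF x0] defs[symmetric]
      by (simp add: algebra_simps)
    then show ?thesis
      by (simp only: sum.distrib sum_distrib_left[symmetric] gg tr\<Phi> inner_commute[of g "Q' x"])
  qed
  have xx: "(\<Sum>i\<in>Basis. (x \<bullet> i) * (v \<bullet> i)) = x \<bullet> v" for v
    by (rule euclidean_inner[symmetric])
  have S4: "(\<Sum>i\<in>Basis. \<Xi>_grad i x \<bullet> i) = 2 * \<eta>' * q"
  proof -
    have "\<Xi>_grad i x \<bullet> i = \<eta> * q / s + \<eta> / s * ((x \<bullet> i) * (Q' x \<bullet> i))
        - 2 * \<eta> * q / s\<^sup>2 * ((x \<bullet> i) * (x \<bullet> i)) + 2 * \<eta>' * q / s * ((x \<bullet> i) * (x \<bullet> i))" if "i \<in> Basis" for i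
      unfolding \<Xi>_grad_def inner_add_left inner_scaleR_left defs[symmetric]
      using that by (simp add: algebra_simps)
    then have "(\<Sum>i\<in>Basis. \<Xi>_grad i x \<bullet> i) = (\<Sum>i\<in>(Basis::'a set). \<eta> * q / s + \<eta> / s * ((x \<bullet> i) * (Q' x \<bullet> i))
        - 2 * \<eta> * q / s\<^sup>2 * ((x \<bullet> i) * (x \<bullet> i)) + 2 * \<eta>' * q / s * ((x \<bullet> i) * (x \<bullet> i)))"
      by (rule sum.cong[OF refl])
    also have "\<dots> = 3 * (\<eta> * q / s) + \<eta> / s * (- q) - 2 * \<eta> * q / s\<^sup>2 * s + 2 * \<eta>' * q / s * s"
      unfolding sum.distrib sum_subtractf sum_distrib_left[symmetric] xx
      using dim Q'x by (simp add: s_def inner_commute)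
    also have "\<dots> = 2 * \<eta>' * q"
      using su by (simp add: power2_eq_square)
    finally show ?thesis .
  qed
  have "bochner x = \<eta> / u * (\<Sum>i\<in>Basis. H x i \<bullet> H x i) - \<eta> / u\<^sup>2 * (g \<bullet> H x g)
      - q * (\<eta> / u * q - \<eta> / u\<^sup>2 * (g \<bullet> g) + 2 * \<eta>')
      + (\<eta> / u * (Q' x \<bullet> g) + q * (\<eta> / u * q - \<eta> / u\<^sup>2 * (g \<bullet> g) + 2 * \<eta>')) / 2 + 2 * \<eta>' * q / 2"
    unfolding bochner_def sum_subtractf S1 S2 S3 S4 ..
  also have "\<dots> = \<eta> / u * ((\<Sum>i\<in>Basis. H x i \<bullet> H x i) - q\<^sup>2 / 2 + c / s * (g \<bullet> g - u\<^sup>2 / s))"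
    unfolding Q' gx using su by (simp add: field_simps power2_eq_square)
  finally show ?thesis
    unfolding defs .
qed

lemma Cauchy_Schwarz_radial:
  assumes "x \<noteq> 0"
  shows "(U x)\<^sup>2 / (x \<bullet> x) \<le> G x \<bullet> G x"
  using Cauchy_Schwarz_ineq[of "G x" x] euler[OF assms] assms by (simp add: field_simps)

text \<open>
  The equality case of \<open>Cauchy_Schwarz_radial\<close>: both nonnegative summands of \<^term>\<open>bochner\<close> vanish, since its
  integral is zero.
\<close>

lemma gradient_radial:
  assumes x: "1 < x \<bullet> x" "x \<bullet> x < 4"
  shows "(U x)\<^sup>2 = (G x \<bullet> G x) * (x \<bullet> x)"
proof -
  have nonneg: "(\<Sum>i\<in>Basis. H y i \<bullet> H y i) - (Q y)\<^sup>2 / 2 \<ge> 0" if "y \<noteq> 0" for y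
    using trace_square_le[OF dim that, of "H y"] Hessian_radial[OF that] trace_eq_Q[OF that] by simp
  have bochner_nonneg: "bochner y \<ge> 0" for y
  proof (cases "1 < y \<bullet> y \<and> y \<bullet> y < 4")
    case True
    then have y: "y \<noteq> 0" "y \<bullet> y > 0" by auto
    show ?thesis
      using True bochner_formula[of y] nonneg[OF y(1)] Cauchy_Schwarz_radial[OF y(1)] c_pos y U_pos[OF y(1)]
        bump_pos[of "y \<bullet> y"] by (auto intro!: mult_nonneg_nonneg add_nonneg_nonneg)
  next
    case False
    then show ?thesis
      using bochner_outside by simp
  qed
  have "y \<in> cball 0 2" if "bochner y \<noteq> 0" for y
  proof -
    have "(norm y)\<^sup>2 \<le> 2\<^sup>2"
      using that bochner_outside[of y] by (force simp: power2_norm_eq_inner)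
    then show ?thesis
      using power2_le_imp_le[of "norm y" 2] by simp
  qed
  then have "bounded {y. bochner y \<noteq> 0}"
    by (intro bounded_subset[OF bounded_cball[of 0 2]]) auto
  then have "bochner x = 0"
    by (rule continuous_integral_zero_imp_zero[OF bochner_continuous _ bochner_nonneg bochner_integral])
  moreover have x0: "x \<noteq> 0" "x \<bullet> x > 0"
    using x by auto
  ultimately have "(\<Sum>i\<in>Basis. H x i \<bullet> H x i) - (Q x)\<^sup>2 / 2
     + c / (x \<bullet> x) * (G x \<bullet> G x - (U x)\<^sup>2 / (x \<bullet> x)) = 0"
    using bochner_formula[OF x] U_pos[of x] bump_pos[OF x] by simp
  moreover have "c / (x \<bullet> x) * (G x \<bullet> G x - (U x)\<^sup>2 / (x \<bullet> x)) \<ge> 0"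
    using Cauchy_Schwarz_radial[OF x0(1)] c_pos x0 by simp
  ultimately have "c / (x \<bullet> x) * (G x \<bullet> G x - (U x)\<^sup>2 / (x \<bullet> x)) = 0"
    using nonneg[OF x0(1)] by linarith
  then show ?thesis
    using c_pos x0 by (simp add: field_simps)
qed

end

section \<open>From the sphere to the punctured space\<close>

lemma sphere_grad_deriv:
  assumes v: "v differentiable (at p within S2)" and p: "p \<in> S2"
  shows "(v has_derivative (\<lambda>h. sphere_grad v p \<bullet> h)) (at p within S2)"
    and "sphere_grad v p \<bullet> p = 0"
proof -
  obtain D where D: "(v has_derivative D) (at p within S2)"
    using v by (auto simp: differentiable_def)
  define g where "g = (\<Sum>i\<in>Basis. D i *\<^sub>R i)"
  have lin: "linear D"
    using D by (rule has_derivative_linear)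
  have "D h = g \<bullet> h" for h
  proof -
    have "D h = D (\<Sum>i\<in>Basis. (h \<bullet> i) *\<^sub>R i)"
      by (simp add: euclidean_representation)
    also have "\<dots> = (\<Sum>i\<in>Basis. D i * (i \<bullet> h))"
      by (simp add: linear_sum[OF lin] linear_scale[OF lin] inner_commute[of h] mult.commute)
    also have "\<dots> = g \<bullet> h"
      by (simp add: g_def inner_sum_left)
    finally show ?thesis .
  qed
  then have g: "(v has_derivative (\<lambda>h. g \<bullet> h)) (at p within S2)"
    using D by presburger
  have grad: "sphere_grad v p = tangent_proj p g"
    by (rule sphere_grad_eq[OF g p])
  have "g \<bullet> tangent_proj p h = tangent_proj p g \<bullet> h" for h
    by (simp add: tangent_proj_def inner_diff_left inner_diff_right inner_commute)
  then show "(v has_derivative (\<lambda>h. sphere_grad v p \<bullet> h)) (at p within S2)"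
    using has_derivative_S2_tangent_proj[OF g p] grad by simp
  show "sphere_grad v p \<bullet> p = 0"
    using tangent_proj_tangent[OF p, of g] grad by (simp add: tangent_space_def)
qed

lemma sphere_deriv_works:
  fixes F :: "real ^ 3 \<Rightarrow> 'a::real_normed_vector"
  assumes "F differentiable (at p within S2)" and "p \<in> S2"
  shows "(F has_derivative sphere_deriv F p) (at p within S2)" and "sphere_deriv F p p = 0"
  using theI'[OF sphere_deriv_ex1[OF assms]] by (simp_all add: sphere_deriv_def)

lemma sgn_in_S2: "(x :: real ^ 3) \<noteq> 0 \<Longrightarrow> sgn x \<in> S2"
  by (simp add: norm_sgn)

lemma has_derivative_sgn:
  fixes x :: "real ^ 3"
  assumes x: "x \<noteq> 0"
  shows "(sgn has_derivative (\<lambda>h. (1 / norm x) *\<^sub>R tangent_proj (sgn x) h)) (at x)"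
proof -
  have "((\<lambda>x. inverse (norm x) *\<^sub>R x) has_derivative
      (\<lambda>h. inverse (norm x) *\<^sub>R h + (- (inverse (norm x) * (h \<bullet> sgn x) * inverse (norm x))) *\<^sub>R x)) (at x)"
    by (rule has_derivative_scaleR[OF Deriv.has_derivative_inverse[OF _ has_derivative_norm[OF x]] has_derivative_ident])
      (use x in simp)
  moreover have "(\<lambda>x. inverse (norm x) *\<^sub>R x) = (sgn :: real ^ 3 \<Rightarrow> _)"
    by (simp add: sgn_div_norm fun_eq_iff)
  moreover have "inverse (norm x) *\<^sub>R h + (- (inverse (norm x) * (h \<bullet> sgn x) * inverse (norm x))) *\<^sub>R x
      = (1 / norm x) *\<^sub>R tangent_proj (sgn x) h" for h
    by (simp add: tangent_proj_def sgn_div_norm scaleR_diff_right divide_inverse mult.commute mult.left_commute)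
  ultimately show ?thesis
    by simp
qed

lemma has_derivative_compose_sgn:
  fixes F :: "real ^ 3 \<Rightarrow> 'a::real_normed_vector"
  assumes x: "x \<noteq> 0" and F: "(F has_derivative F') (at (sgn x) within S2)"
  shows "((\<lambda>x. F (sgn x)) has_derivative (\<lambda>h. F' ((1 / norm x) *\<^sub>R tangent_proj (sgn x) h))) (at x)"
proof -
  have "sgn ` (- {0}) \<subseteq> S2"
    using sgn_in_S2 by blast
  then have "((\<lambda>x. F (sgn x)) has_derivative (\<lambda>h. F' ((1 / norm x) *\<^sub>R tangent_proj (sgn x) h)))
      (at x within - {0})"
    by (intro has_derivative_in_compose[OF has_derivative_at_withinI[OF has_derivative_sgn[OF x]]]
        has_derivative_subset[OF F])
  moreover have "at x within - {0} = at x"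
    by (rule at_within_open) (use x in auto)
  ultimately show ?thesis
    by (simp only:)
qed

text \<open>
  The tangential projection in the covariant derivative does not change the trace, because the
  differential of the gradient kills the normal \<open>p\<close>.
\<close>

lemma laplace_beltrami_eq_trace:
  assumes X: "sphere_grad v differentiable (at p within S2)" and p: "p \<in> S2"
  shows "laplace_beltrami v p = (\<Sum>i\<in>Basis. sphere_deriv (sphere_grad v) p i \<bullet> i)"
proof -
  let ?D = "sphere_deriv (sphere_grad v) p"
  have lin: "linear ?D"
    by (rule has_derivative_linear[OF sphere_deriv_works(1)[OF X p]])
  have "(\<Sum>k\<in>UNIV. f (axis k 1) $ k) = (\<Sum>i\<in>Basis. f i \<bullet> i)" for f :: "real ^ 3 \<Rightarrow> real ^ 3"
  proof -
    have B: "(Basis :: (real ^ 3) set) = (\<lambda>k. axis k 1) ` UNIV"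
      by (auto simp: Basis_vec_def)
    have inj: "inj (\<lambda>k::3. axis k (1::real))"
      by (auto simp: inj_on_def axis_eq_axis)
    show ?thesis
      unfolding B sum.reindex[OF inj] by (simp add: inner_axis)
  qed
  then have "laplace_beltrami v p = (\<Sum>i\<in>Basis. tangent_proj p (?D i) \<bullet> i)"
    by (simp add: laplace_beltrami_def sphere_div_def trace_def matrix_def cov_deriv_def)
  also have "\<dots> = (\<Sum>i\<in>Basis. ?D i \<bullet> i) - (\<Sum>i\<in>Basis. (?D i \<bullet> p) * (p \<bullet> i))"
    by (simp add: tangent_proj_def inner_diff_left sum_subtractf)
  also have "(\<Sum>i\<in>Basis. (?D i \<bullet> p) * (p \<bullet> i)) = ?D (\<Sum>i\<in>Basis. (p \<bullet> i) *\<^sub>R i) \<bullet> p"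
    by (simp add: linear_sum[OF lin] linear_scale[OF lin] inner_sum_left mult.commute)
  also have "\<dots> = 0"
    using sphere_deriv_works(2)[OF X p] by (simp add: euclidean_representation)
  finally show ?thesis by simp
qed

text \<open>
  For \<open>U(x) = \<bar>x\<bar> exp (- v(x / \<bar>x\<bar>))\<close> and \<open>n = x / \<bar>x\<bar>\<close> one finds \<open>\<nabla>U = exp (- v) (n - X)\<close> with the
  spherical gradient \<open>X\<close> of \<open>v\<close>. As \<open>X\<close> is orthogonal to \<open>n\<close>, the gradient of \<open>U\<close> is radial exactly where
  \<open>X\<close> vanishes.
\<close>

lemma sphere_grad_zero:
  fixes v :: "real ^ 3 \<Rightarrow> real"
  assumes \<beta>: "\<beta> < 1" and v: "C2_on_S2 v"
    and eq: "\<forall>p\<in>S2. - laplace_beltrami v p + \<beta> = exp (2 * v p)"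
    and p: "p \<in> S2"
  shows "sphere_grad v p = 0"
proof -
  define X where "X = sphere_grad v"
  define D where "D = sphere_deriv X"
  have dv: "v differentiable (at n within S2)" and dX: "X differentiable (at n within S2)" if "n \<in> S2" for n
    using v that unfolding C2_on_S2_def C1_on_S2_def X_def by auto
  have Dcont: "continuous_on S2 (\<lambda>p. D p h)" for h
    using v unfolding C2_on_S2_def C1_on_S2_def X_def D_def by blast
  note vX = sphere_grad_deriv[OF dv, folded X_def]
  note XD = sphere_deriv_works[OF dX, folded D_def]
  define U where "U x = norm x * exp (- v (sgn x))" for x
  define G where "G x = exp (- v (sgn x)) *\<^sub>R (sgn x - X (sgn x))" for x
  define H where "H x h = (exp (- v (sgn x)) / norm x) *\<^sub>R
      (tangent_proj (sgn x) h - D (sgn x) h - (X (sgn x) \<bullet> h) *\<^sub>R (sgn x - X (sgn x)))" for x h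
  have nn: "n \<bullet> n = 1" if "n \<in> S2" for n
    using that by (simp add: dot_square_norm)
  have XX: "X n \<bullet> n = 0" "n \<bullet> X n = 0" if "n \<in> S2" for n
    using vX(2)[OF that that] by (simp_all add: inner_commute)
  have GG: "G x \<bullet> G x = (exp (- v (sgn x)))\<^sup>2 * (1 + X (sgn x) \<bullet> X (sgn x))" if "x \<noteq> 0" for x
    using nn[OF sgn_in_S2[OF that]] XX[OF sgn_in_S2[OF that]]
    by (simp add: G_def inner_diff_left inner_diff_right power2_eq_square distrib_left)
  have exp_deriv: "((\<lambda>x. exp (- v (sgn x))) has_derivative
      (\<lambda>h. - (exp (- v (sgn x)) / norm x * (X (sgn x) \<bullet> h)))) (at x)" if x: "x \<noteq> 0" for x
  proof -
    let ?n = "sgn x"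
    have "X ?n \<bullet> ((1 / norm x) *\<^sub>R tangent_proj ?n h) = (X ?n \<bullet> h) / norm x" for h
      using XX[OF sgn_in_S2[OF x]] by (simp add: tangent_proj_def inner_diff_right)
    then have "((\<lambda>x. v (sgn x)) has_derivative (\<lambda>h. (X ?n \<bullet> h) / norm x)) (at x)"
      using has_derivative_compose_sgn[OF x vX(1)[OF sgn_in_S2[OF x] sgn_in_S2[OF x]]] by (simp only:)
    from has_derivative_exp[OF has_derivative_minus[OF this]] show ?thesis
      by (simp add: mult.commute)
  qed
  have "homogeneous_solution U G H (1 - \<beta>)"
  proof
    show "DIM(real ^ 3) = 3" by simp
    show "1 - \<beta> > 0" using \<beta> by simp
  next
    fix x :: "real ^ 3" assume x: "x \<noteq> 0"
    let ?n = "sgn x" and ?e = "exp (- v (sgn x))"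
    have n: "?n \<in> S2"
      by (rule sgn_in_S2[OF x])
    have xn: "x = norm x *\<^sub>R ?n"
      by (simp add: sgn_div_norm x)
    show "U x > 0"
      using x by (simp add: U_def)
    have "(U has_derivative (\<lambda>h. norm x * - (?e / norm x * (X ?n \<bullet> h)) + h \<bullet> ?n * ?e)) (at x)"
      unfolding U_def[abs_def]
      by (rule has_derivative_mult[OF has_derivative_norm[OF x] exp_deriv[OF x]])
    then show "(U has_derivative (\<lambda>h. G x \<bullet> h)) (at x)"
      using x by (simp add: G_def inner_diff_left inner_commute[of ?n] algebra_simps)
    have "((\<lambda>x. sgn x - X (sgn x)) has_derivative (\<lambda>h. (1 / norm x) *\<^sub>R tangent_proj ?n h
        - D ?n ((1 / norm x) *\<^sub>R tangent_proj ?n h))) (at x)"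
      by (rule has_derivative_diff[OF has_derivative_sgn[OF x] has_derivative_compose_sgn[OF x XD(1)[OF n n]]])
    moreover have "D ?n ((1 / norm x) *\<^sub>R tangent_proj ?n h) = (1 / norm x) *\<^sub>R D ?n h" for h
    proof -
      have lin: "linear (D ?n)"
        by (rule has_derivative_linear[OF XD(1)[OF n n]])
      show ?thesis
        by (simp add: tangent_proj_def linear_scale[OF lin] linear_diff[OF lin] XD(2)[OF n n])
    qed
    ultimately have "((\<lambda>x. sgn x - X (sgn x)) has_derivative
        (\<lambda>h. (1 / norm x) *\<^sub>R tangent_proj ?n h - (1 / norm x) *\<^sub>R D ?n h)) (at x)"
      by simp
    from has_derivative_scaleR[OF exp_deriv[OF x] this]
    show "(G has_derivative H x) (at x)"
      by (simp add: G_def[abs_def] H_def[abs_def] scaleR_diff_right algebra_simps)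
    show "G x \<bullet> x = U x"
    proof -
      have "G x \<bullet> x = norm x * (G x \<bullet> ?n)"
        by (subst xn) simp
      also have "G x \<bullet> ?n = ?e"
        using nn[OF n] XX[OF n] by (simp add: G_def inner_diff_left)
      finally show ?thesis
        by (simp add: U_def)
    qed
    have trP: "(\<Sum>i\<in>Basis. tangent_proj ?n i \<bullet> i) = 2"
    proof -
      have "(\<Sum>i\<in>Basis. tangent_proj ?n i \<bullet> i) = (\<Sum>i\<in>(Basis::(real^3) set). 1 - (?n \<bullet> i) * (?n \<bullet> i))"
        by (rule sum.cong) (auto simp: tangent_proj_def inner_diff_left inner_commute[of _ ?n])
      also have "\<dots> = 3 - ?n \<bullet> ?n"
        unfolding sum_subtractf euclidean_inner[symmetric] by simp
      finally show ?thesis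
        using nn[OF n] by simp
    qed
    have trD: "(\<Sum>i\<in>Basis. D ?n i \<bullet> i) = \<beta> - exp (2 * v ?n)"
      using laplace_beltrami_eq_trace[OF dX[OF n, unfolded X_def] n] eq n
      by (simp add: D_def X_def algebra_simps)
    have trX: "(\<Sum>i\<in>Basis. (X ?n \<bullet> i) * ((?n - X ?n) \<bullet> i)) = - (X ?n \<bullet> X ?n)"
      unfolding euclidean_inner[symmetric] using XX[OF n] by (simp add: inner_diff_right)
    have tr: "(\<Sum>i\<in>Basis. H x i \<bullet> i) = ?e / norm x * (2 - (\<beta> - exp (2 * v ?n)) + X ?n \<bullet> X ?n)"
    proof -
      have "(\<Sum>i\<in>Basis. H x i \<bullet> i) = (\<Sum>i\<in>Basis. ?e / norm x *
          (tangent_proj ?n i \<bullet> i - D ?n i \<bullet> i - (X ?n \<bullet> i) * ((?n - X ?n) \<bullet> i)))"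
        unfolding H_def by (simp only: inner_scaleR_left inner_diff_left)
      also have "\<dots> = ?e / norm x * (2 - (\<beta> - exp (2 * v ?n)) + X ?n \<bullet> X ?n)"
        by (simp only: sum_distrib_left[symmetric] sum_subtractf trP trD trX) simp
      finally show ?thesis .
    qed
    have ee: "?e\<^sup>2 * exp (2 * v ?n) = 1"
      by (simp add: power2_eq_square flip: exp_add)
    have "(U x)\<^sup>2 / (x \<bullet> x) = ?e\<^sup>2"
      using x by (simp add: U_def power_mult_distrib power2_norm_eq_inner)
    moreover have "U x * (?e / norm x) = ?e\<^sup>2"
      using x by (simp add: U_def power2_eq_square)
    ultimately show "U x * (\<Sum>i\<in>Basis. H x i \<bullet> i) = G x \<bullet> G x + 1 + (1 - \<beta>) * (U x)\<^sup>2 / (x \<bullet> x)"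
      unfolding tr GG[OF x] mult.assoc[symmetric] times_divide_eq_right[symmetric]
      using ee by (simp add: algebra_simps)
  next
    fix h :: "real ^ 3"
    have csgn: "continuous_on (- {0}) (sgn :: real ^ 3 \<Rightarrow> real ^ 3)"
      by (intro continuous_on_sgn continuous_on_id) auto
    have sub: "sgn ` (- {0 :: real ^ 3}) \<subseteq> S2"
      using sgn_in_S2 by blast
    have cX: "continuous_on S2 X"
      using dX by (simp add: continuous_on_eq_continuous_within differentiable_imp_continuous_within)
    have cv: "continuous_on S2 v"
      using dv by (simp add: continuous_on_eq_continuous_within differentiable_imp_continuous_within)
    show "continuous_on (- {0}) (\<lambda>x. H x h)"
      unfolding H_def tangent_proj_def
      by (intro continuous_intros csgn continuous_on_compose2[OF cX csgn sub]
          continuous_on_compose2[OF cv csgn sub] continuous_on_compose2[OF Dcont csgn sub]) auto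
  qed
  then interpret homogeneous_solution U G H "1 - \<beta>" .
  \<comment> \<open>A point on the ray through \<open>p\<close> that lies in the shell \<open>1 < \<bar>x\<bar>\<^sup>2 < 4\<close>.\<close>
  define x where "x = (3 / 2) *\<^sub>R p"
  have x: "sgn x = p" "x \<bullet> x = 9 / 4" "x \<noteq> 0" "norm x = 3 / 2"
    using p nn[OF p] by (auto simp: x_def sgn_scaleR sgn_div_norm)
  have "(U x)\<^sup>2 = (G x \<bullet> G x) * (x \<bullet> x)"
    by (rule gradient_radial) (simp_all add: x)
  then have "X p \<bullet> X p = 0"
    unfolding GG[OF x(3)] by (simp add: x U_def power_mult_distrib field_simps)
  then show ?thesis
    by (simp add: X_def)
qed

theorem corollary1p5:
  fixes \<beta> :: real and v :: "real ^ 3 \<Rightarrow> real"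
  assumes "0 < \<beta>" and "\<beta> < 1"
    and "C2_on_S2 v"
    and "\<forall>p\<in>S2. - laplace_beltrami v p + \<beta> = exp (2 * v p)"
  shows "v constant_on S2"
proof -
  \<comment> \<open>The punctured space is open and connected, so a vanishing derivative can be integrated there.\<close>
  let ?V = "\<lambda>x. v (sgn x)"
  have V: "(?V has_derivative (\<lambda>h. 0)) (at x)" if x: "x \<noteq> 0" for x
  proof -
    have "v differentiable (at (sgn x) within S2)"
      using assms(3) sgn_in_S2[OF x] unfolding C2_on_S2_def C1_on_S2_def by blast
    then have "(v has_derivative (\<lambda>h. 0)) (at (sgn x) within S2)"
      using sphere_grad_deriv(1)[of v, OF _ sgn_in_S2[OF x]]
      unfolding sphere_grad_zero[OF assms(2-4) sgn_in_S2[OF x]] inner_zero_left by blast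
    then show ?thesis
      by (rule has_derivative_compose_sgn[OF x])
  qed
  have "?V constant_on - {0}"
  proof (rule has_derivative_zero_connected_constant_on[where K = "{}"])
    show "connected (- {0 :: real ^ 3})"
      by (rule connected_punctured_universe) simp
    show "continuous_on (- {0}) ?V"
      by (rule continuous_at_imp_continuous_on) (use has_derivative_continuous[OF V] in blast)
    show "\<forall>x\<in>- {0} - {}. (?V has_derivative (\<lambda>h. 0)) (at x within - {0})"
      using has_derivative_at_withinI[OF V] by blast
  qed auto
  then obtain k where k: "\<And>x. x \<noteq> 0 \<Longrightarrow> v (sgn x) = k"
    unfolding constant_on_def by auto
  have "v p = k" if p: "p \<in> S2" for p
  proof -
    have "p \<noteq> 0" "sgn p = p"
      using p by (auto simp: sgn_div_norm)
    then show ?thesis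
      using k[of p] by simp
  qed
  then show ?thesis
    unfolding constant_on_def by blast
qed

end
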